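(* Let $0<a,b<1$, $K_1=aI$, $K_2=bI$, and let $V_1,V_2\in\mathcal A$ be freely independent unitaries with $\tau(V_1)=\tau(V_2)=0$. For $z\in\mathbb C$ let $$\rho(z)=\left[1+\frac{2a}{1-a}|1+z|^2+\frac{2b}{1-b}|z|^2+\left(\frac{a}{1-a}|1+z|^2-\frac{b}{1-b}|z|^2\right)^2\right]^{1/2},$$ $$k_1(z)=\frac12\left(1+\rho(z)-\frac{a}{1-a}|z+1|^2+\frac{b}{1-b}|z|^2\right),\qquad k_2(z)=\frac12\left(1+\rho(z)+\frac{a}{1-a}|z+1|^2-\frac{b}{1-b}|z|^2\right),$$ and for $z,w\in\mathbb C$ let $$O_1(z,w)=\frac{a(1+z)(1+\overline w)}{(1-a)k_1(z)k_1(w)},\qquad O_2(z,w)=\frac{b\,z\overline w}{(1-b)k_2(z)k_2(w)}.$$ Then for all $z,w\in\mathbb C$, $$d(z,w)=\left(\frac1{\rho(z)}+\frac1{\rho(w)}-\frac{2}{\rho(z)\rho(w)}\operatorname{Re}\left(\frac{(1+\overline{O_1(z,w)})(1+O_2(z,w))}{1-\overline{O_1(z,w)}\,O_2(z,w)}\right)\right)^{1/2},$$ and $d(z,\infty)=\frac1{\sqrt{\rho(z)}}$ for all $z\in\mathbb C$.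
   Context: $\mathcal A\subset\mathcal B(\mathcal H)$ is a type II$_1$ factor with unique faithful normal tracial state $\tau$; $\mathcal M=\mathcal A\otimes M_2(\mathbb C)$ with tracial state $\tau_2=\tau\otimes\mathrm{tr}$, $\mathrm{tr}$ the normalized trace on $M_2(\mathbb C)$; $\|A\|_2=\tau_2(A^*A)^{1/2}$. Unitaries are freely independent if the von Neumann algebras they generate are freely independent with respect to $\tau$. For $z\in\mathbb C$ let $$T(z)=(1+z)\sqrt{K_1(I-K_1)^{-1}}\,V_1-z\sqrt{K_2(I-K_2)^{-1}}\,V_2$$ and $$Q(z)=\begin{pmatrix} I-(I+T(z)T(z)^* )^{-1} & T(z)(I+T(z)^*T(z))^{-1}\\ (I+T(z)^*T(z))^{-1}T(z)^* & (I+T(z)^*T(z))^{-1}\end{pmatrix}\in\mathcal M,$$ and let $Q(\infty)=\begin{pmatrix}I&0\\0&0\end{pmatrix}$. $d(z,w)=\|Q(z)-Q(w)\|_2$ for $z,w\in\mathbb C\cup\{\infty\}$. Standing assumption: $\ker\bigl(\sqrt{K_1(I-K_1)^{-1}}V_1-\sqrt{K_2(I-K_2)^{-1}}V_2\bigr)=\{0\}$. *)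

theory Defs
  imports "HOL-Analysis.Analysis"
begin

section \<open>Complex Hilbert spaces and bounded operators\<close>

class scaleC =
  fixes scaleC :: "complex \<Rightarrow> 'a \<Rightarrow> 'a"  (infixr "*\<^sub>C" 75)

text \<open>
  The norm and the topology are those of the underlying real inner product space, whose inner
  product is the real part of the complex one. The Hilbert space is required to be nonzero, so
  that the bounded operators form a ring with zero and one distinct; a type II-one factor cannot
  act on the zero space.
\<close>

class chilbert_space = real_inner + complete_space + scaleC +
  fixes cinner :: "'a \<Rightarrow> 'a \<Rightarrow> complex"
  assumes scaleC_add_right: "c *\<^sub>C (x + y) = c *\<^sub>C x + c *\<^sub>C y"
    and scaleC_add_left: "(c + d) *\<^sub>C x = c *\<^sub>C x + d *\<^sub>C x"
    and scaleC_scaleC: "c *\<^sub>C d *\<^sub>C x = (c * d) *\<^sub>C x"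
    and scaleC_of_real: "complex_of_real r *\<^sub>C x = r *\<^sub>R x"
    and cinner_commute: "cinner x y = cnj (cinner y x)"
    and cinner_add_left: "cinner (x + y) z = cinner x z + cinner y z"
    and cinner_scaleC_left: "cinner (c *\<^sub>C x) y = c * cinner x y"
    and Re_cinner: "Re (cinner x y) = inner x y"
    and ex_nonzero: "\<exists>x. x \<noteq> 0"

lemma bounded_linear_scaleC: "bounded_linear ((*\<^sub>C) c :: 'a::chilbert_space \<Rightarrow> 'a)"
proof (rule bounded_linear_intro[where K = "cmod c"])
  show "c *\<^sub>C (r *\<^sub>R x) = r *\<^sub>R (c *\<^sub>C x)" for r and x :: 'a
    by (simp add: scaleC_of_real[symmetric] scaleC_scaleC mult.commute)
  show "norm (c *\<^sub>C x) \<le> norm x * cmod c" for x :: 'a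
  proof -
    have im: "Im (cinner x x) = 0"
      using cinner_commute[of x x] by (simp add: complex_eq_iff)
    have "cinner (c *\<^sub>C x) (c *\<^sub>C x) = c * cnj c * cinner x x"
      by (subst cinner_scaleC_left, subst cinner_commute, subst cinner_scaleC_left)
        (simp add: cinner_commute[of x x, symmetric])
    also have "c * cnj c = complex_of_real ((cmod c)\<^sup>2)"
      by (simp add: complex_norm_square[symmetric])
    finally have "inner (c *\<^sub>C x) (c *\<^sub>C x) = (cmod c)\<^sup>2 * inner x x"
      using im by (simp add: Re_cinner[symmetric])
    then have "(norm (c *\<^sub>C x))\<^sup>2 = (norm x * cmod c)\<^sup>2"
      by (simp add: power2_norm_eq_inner[symmetric] power_mult_distrib mult.commute)
    then show ?thesis
      by (simp add: power2_eq_iff_nonneg)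
  qed
qed (rule scaleC_add_right)

typedef (overloaded) 'h bop =
  "{f :: 'h \<Rightarrow>\<^sub>L ('h::chilbert_space). \<forall>c x. blinfun_apply f (c *\<^sub>C x) = c *\<^sub>C blinfun_apply f x}"
  morphisms blinfun_of_bop Abs_bop
  by (rule exI[of _ id_blinfun]) simp

setup_lifting type_definition_bop

lift_definition bop_apply :: "'h::chilbert_space bop \<Rightarrow> 'h \<Rightarrow> 'h" is blinfun_apply .

lemma bop_eqI: "(\<And>x. bop_apply A x = bop_apply B x) \<Longrightarrow> A = B"
  by transfer (rule blinfun_eqI)

lemma bop_apply_add_right: "bop_apply A (x + y) = bop_apply A x + bop_apply A y"
  by transfer (rule blinfun.add_right)

lemma bop_apply_zero_right: "bop_apply A 0 = 0"
  by transfer (rule blinfun.zero_right)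

lemma scaleC_zero_right: "c *\<^sub>C (0::'a::chilbert_space) = 0"
  by (rule linear_0[OF bounded_linear.linear[OF bounded_linear_scaleC]])

lemma scaleC_minus_right: "c *\<^sub>C (- x) = - (c *\<^sub>C (x::'a::chilbert_space))"
  by (rule linear_neg[OF bounded_linear.linear[OF bounded_linear_scaleC]])

lemma scaleC_diff_right: "c *\<^sub>C (x - y) = c *\<^sub>C x - c *\<^sub>C (y::'a::chilbert_space)"
  by (rule linear_diff[OF bounded_linear.linear[OF bounded_linear_scaleC]])

instantiation bop :: (chilbert_space) ring_1
begin

lift_definition zero_bop :: "'a bop" is 0 by (simp add: scaleC_zero_right)
lift_definition one_bop :: "'a bop" is id_blinfun by simp
lift_definition plus_bop :: "'a bop \<Rightarrow> 'a bop \<Rightarrow> 'a bop" is "(+)"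
  by (simp add: blinfun.add_left scaleC_add_right)
lift_definition minus_bop :: "'a bop \<Rightarrow> 'a bop \<Rightarrow> 'a bop" is "(-)"
  by (simp add: blinfun.diff_left scaleC_diff_right)
lift_definition uminus_bop :: "'a bop \<Rightarrow> 'a bop" is uminus
  by (simp add: blinfun.minus_left scaleC_minus_right)
lift_definition times_bop :: "'a bop \<Rightarrow> 'a bop \<Rightarrow> 'a bop" is "(o\<^sub>L)" by simp

instance
proof
  fix A B C :: "'a bop"
  show "A * B * C = A * (B * C)" by transfer (rule blinfun_eqI, simp)
  show "A + B + C = A + (B + C)" by transfer (rule add.assoc)
  show "A + B = B + A" by transfer (rule add.commute)
  show "0 + A = A" by transfer simp
  show "- A + A = 0" by transfer simp
  show "A - B = A + - B" by transfer simp
  show "1 * A = A" by transfer (rule blinfun_eqI, simp)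
  show "A * 1 = A" by transfer (rule blinfun_eqI, simp)
  show "(A + B) * C = A * C + B * C"
    by transfer (rule blinfun_eqI, simp add: blinfun.add_left)
  show "A * (B + C) = A * B + A * C"
    by transfer (rule blinfun_eqI, simp add: blinfun.add_left blinfun.add_right)
  show "(0::'a bop) \<noteq> 1"
  proof
    assume "(0::'a bop) = 1"
    then have "bop_apply (0::'a bop) x = bop_apply 1 x" for x by simp
    then have "x = 0" for x :: 'a by transfer simp
    then show False using ex_nonzero[where 'a = 'a] by blast
  qed
qed

end

instantiation bop :: (chilbert_space) scaleC
begin

lift_definition scaleC_bop :: "complex \<Rightarrow> 'a bop \<Rightarrow> 'a bop"
  is "\<lambda>c f. Blinfun (\<lambda>x. c *\<^sub>C blinfun_apply f x)"
  by (subst (1 2) bounded_linear_Blinfun_apply)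
    (auto intro: bounded_linear_compose[OF bounded_linear_scaleC] blinfun.bounded_linear_right
      simp: scaleC_scaleC mult.commute)

instance ..

end

lemma bop_apply_scaleC: "bop_apply (c *\<^sub>C A) x = c *\<^sub>C bop_apply A x"
  by transfer (subst bounded_linear_Blinfun_apply,
    auto intro: bounded_linear_compose[OF bounded_linear_scaleC] blinfun.bounded_linear_right)

definition star :: "'h::chilbert_space bop \<Rightarrow> 'h bop" where
  "star A = (THE B. \<forall>x y. cinner (bop_apply A x) y = cinner x (bop_apply B y))"

definition positive_op :: "'h::chilbert_space bop \<Rightarrow> bool" where
  "positive_op A \<longleftrightarrow> star A = A \<and> (\<forall>x. 0 \<le> Re (cinner (bop_apply A x) x))"

definition unitary_op :: "'h::chilbert_space bop \<Rightarrow> bool" where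
  "unitary_op U \<longleftrightarrow> star U * U = 1 \<and> U * star U = 1"

definition projection_op :: "'h::chilbert_space bop \<Rightarrow> bool" where
  "projection_op P \<longleftrightarrow> star P = P \<and> P * P = P"

definition op_ker :: "'h::chilbert_space bop \<Rightarrow> 'h set" where
  "op_ker A = {x. bop_apply A x = 0}"

definition op_inv :: "'h::chilbert_space bop \<Rightarrow> 'h bop" where
  "op_inv A = (THE B. A * B = 1 \<and> B * A = 1)"

definition op_sqrt :: "'h::chilbert_space bop \<Rightarrow> 'h bop" where
  "op_sqrt A = (THE B. positive_op B \<and> B * B = A)"


section \<open>Von Neumann algebras and traces\<close>

definition commutant :: "'h::chilbert_space bop set \<Rightarrow> 'h bop set" where
  "commutant S = {A. \<forall>B\<in>S. A * B = B * A}"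

definition vN_algebra :: "'h::chilbert_space bop set \<Rightarrow> bool" where
  "vN_algebra N \<longleftrightarrow> (\<forall>A\<in>N. star A \<in> N) \<and> commutant (commutant N) = N"

definition vN_generated :: "'h::chilbert_space bop set \<Rightarrow> 'h bop set" where
  "vN_generated S = \<Inter>{N. vN_algebra N \<and> S \<subseteq> N}"

definition factor :: "'h::chilbert_space bop set \<Rightarrow> bool" where
  "factor N \<longleftrightarrow> vN_algebra N \<and> N \<inter> commutant N = range (\<lambda>c. c *\<^sub>C 1)"

text \<open>
  A factor is of type II-one if its identity is a finite projection and it has no nonzero abelian
  projection.
\<close>

definition type_II1_factor :: "'h::chilbert_space bop set \<Rightarrow> bool" where
  "type_II1_factor N \<longleftrightarrow>
     factor N \<and>
     (\<forall>V\<in>N. star V * V = 1 \<longrightarrow> V * star V = 1) \<and>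
     (\<forall>P\<in>N. projection_op P \<and>
        (\<forall>A\<in>N. \<forall>B\<in>N. (P * A * P) * (P * B * P) = (P * B * P) * (P * A * P)) \<longrightarrow> P = 0)"

text \<open>
  Functionals on an algebra \<open>N\<close> are total functions on operators of which only the values
  on \<open>N\<close> matter.
\<close>

definition tracial_state :: "'h::chilbert_space bop set \<Rightarrow> ('h bop \<Rightarrow> complex) \<Rightarrow> bool" where
  "tracial_state N \<tau> \<longleftrightarrow>
     (\<forall>A\<in>N. \<forall>B\<in>N. \<tau> (A + B) = \<tau> A + \<tau> B) \<and>
     (\<forall>c. \<forall>A\<in>N. \<tau> (c *\<^sub>C A) = c * \<tau> A) \<and>
     (\<forall>A\<in>N. Im (\<tau> (star A * A)) = 0 \<and> 0 \<le> Re (\<tau> (star A * A))) \<and>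
     \<tau> 1 = 1 \<and>
     (\<forall>A\<in>N. \<forall>B\<in>N. \<tau> (A * B) = \<tau> (B * A))"

definition faithful :: "'h::chilbert_space bop set \<Rightarrow> ('h bop \<Rightarrow> complex) \<Rightarrow> bool" where
  "faithful N \<tau> \<longleftrightarrow> (\<forall>A\<in>N. \<tau> (star A * A) = 0 \<longrightarrow> A = 0)"

definition selfadjoint_part :: "'h::chilbert_space bop set \<Rightarrow> 'h bop set" where
  "selfadjoint_part N = {A\<in>N. star A = A}"

definition op_le :: "'h::chilbert_space bop \<Rightarrow> 'h bop \<Rightarrow> bool" where
  "op_le A B \<longleftrightarrow> positive_op (B - A)"

definition is_op_lub :: "'h::chilbert_space bop set \<Rightarrow> 'h bop set \<Rightarrow> 'h bop \<Rightarrow> bool" where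
  "is_op_lub N D S \<longleftrightarrow>
     S \<in> selfadjoint_part N \<and> (\<forall>A\<in>D. op_le A S) \<and>
     (\<forall>B\<in>selfadjoint_part N. (\<forall>A\<in>D. op_le A B) \<longrightarrow> op_le S B)"

text \<open>
  Normality of a state: it preserves suprema of bounded upward directed families of selfadjoint
  elements. The values of a state on selfadjoint elements are real.
\<close>

definition normal_state :: "'h::chilbert_space bop set \<Rightarrow> ('h bop \<Rightarrow> complex) \<Rightarrow> bool" where
  "normal_state N \<tau> \<longleftrightarrow>
     (\<forall>D S. D \<subseteq> selfadjoint_part N \<and> D \<noteq> {} \<and>
        (\<forall>A\<in>D. \<forall>B\<in>D. \<exists>C\<in>D. op_le A C \<and> op_le B C) \<and> is_op_lub N D S \<longrightarrow>
        Re (\<tau> S) = (SUP A\<in>D. Re (\<tau> A)))"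

text \<open>
  A word is a list of pairs of an index \<open>i\<close> and an element of \<open>N i\<close>;
  \<open>distinct_adj\<close> says that neighbouring letters come from different algebras.
\<close>

definition freely_independent :: "('h::chilbert_space bop \<Rightarrow> complex) \<Rightarrow> ('i \<Rightarrow> 'h bop set) \<Rightarrow> bool" where
  "freely_independent \<tau> N \<longleftrightarrow>
     (\<forall>xs. xs \<noteq> [] \<and> (\<forall>(i, A)\<in>set xs. A \<in> N i \<and> \<tau> A = 0) \<and> distinct_adj (map fst xs) \<longrightarrow>
        \<tau> (prod_list (map snd xs)) = 0)"

definition free_unitaries :: "('h::chilbert_space bop \<Rightarrow> complex) \<Rightarrow> 'h bop \<Rightarrow> 'h bop \<Rightarrow> bool" where
  "free_unitaries \<tau> U V \<longleftrightarrow>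
     unitary_op U \<and> unitary_op V \<and>
     freely_independent \<tau> (\<lambda>first::bool. vN_generated {if first then U else V})"


section \<open>Two by two matrices over the algebra\<close>

text \<open>
  The tensor product of \<open>N\<close> with the two by two complex matrices is represented by the
  two by two matrices with entries in \<open>N\<close>; \<open>tau2\<close> is the tensor product of
  \<open>\<tau>\<close> with the normalized trace.
\<close>

definition mstar :: "'h::chilbert_space bop^2^2 \<Rightarrow> 'h bop^2^2" where
  "mstar X = (\<chi> i j. star (X $ j $ i))"

definition tau2 :: "('h::chilbert_space bop \<Rightarrow> complex) \<Rightarrow> 'h bop^2^2 \<Rightarrow> complex" where
  "tau2 \<tau> X = (\<tau> (X $ 1 $ 1) + \<tau> (X $ 2 $ 2)) / 2"

definition norm2 :: "('h::chilbert_space bop \<Rightarrow> complex) \<Rightarrow> 'h bop^2^2 \<Rightarrow> real" where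
  "norm2 \<tau> X = sqrt (Re (tau2 \<tau> (mstar X ** X)))"


section \<open>The projections and the metric\<close>

definition T_op :: "'h::chilbert_space bop \<Rightarrow> 'h bop \<Rightarrow> 'h bop \<Rightarrow> 'h bop \<Rightarrow> complex \<Rightarrow> 'h bop" where
  "T_op K1 K2 V1 V2 z =
     (1 + z) *\<^sub>C (op_sqrt (K1 * op_inv (1 - K1)) * V1) - z *\<^sub>C (op_sqrt (K2 * op_inv (1 - K2)) * V2)"

datatype ext_complex = Fin complex | Infty

fun Q_proj :: "'h::chilbert_space bop \<Rightarrow> 'h bop \<Rightarrow> 'h bop \<Rightarrow> 'h bop \<Rightarrow> ext_complex \<Rightarrow> 'h bop^2^2" where
  "Q_proj K1 K2 V1 V2 (Fin z) =
     (let T = T_op K1 K2 V1 V2 z in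
      vector [vector [1 - op_inv (1 + T * star T), T * op_inv (1 + star T * T)],
              vector [op_inv (1 + star T * T) * star T, op_inv (1 + star T * T)]])"
| "Q_proj K1 K2 V1 V2 Infty = vector [vector [1, 0], vector [0, 0]]"

definition d_metric :: "('h::chilbert_space bop \<Rightarrow> complex) \<Rightarrow> 'h bop \<Rightarrow> 'h bop \<Rightarrow> 'h bop \<Rightarrow> 'h bop \<Rightarrow>
    ext_complex \<Rightarrow> ext_complex \<Rightarrow> real" where
  "d_metric \<tau> K1 K2 V1 V2 z w = norm2 \<tau> (Q_proj K1 K2 V1 V2 z - Q_proj K1 K2 V1 V2 w)"

definition rho :: "real \<Rightarrow> real \<Rightarrow> complex \<Rightarrow> real" where
  "rho a b z = sqrt (1 + 2 * a / (1 - a) * (cmod (1 + z))\<^sup>2 + 2 * b / (1 - b) * (cmod z)\<^sup>2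
     + (a / (1 - a) * (cmod (1 + z))\<^sup>2 - b / (1 - b) * (cmod z)\<^sup>2)\<^sup>2)"

definition k1 :: "real \<Rightarrow> real \<Rightarrow> complex \<Rightarrow> real" where
  "k1 a b z = (1 + rho a b z - a / (1 - a) * (cmod (z + 1))\<^sup>2 + b / (1 - b) * (cmod z)\<^sup>2) / 2"

definition k2 :: "real \<Rightarrow> real \<Rightarrow> complex \<Rightarrow> real" where
  "k2 a b z = (1 + rho a b z + a / (1 - a) * (cmod (z + 1))\<^sup>2 - b / (1 - b) * (cmod z)\<^sup>2) / 2"

definition O1 :: "real \<Rightarrow> real \<Rightarrow> complex \<Rightarrow> complex \<Rightarrow> complex" where
  "O1 a b z w = of_real a * (1 + z) * (1 + cnj w) / of_real ((1 - a) * k1 a b z * k1 a b w)"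

definition O2 :: "real \<Rightarrow> real \<Rightarrow> complex \<Rightarrow> complex \<Rightarrow> complex" where
  "O2 a b z w = of_real b * z * cnj w / of_real ((1 - b) * k2 a b z * k2 a b w)"

end

theory Submission
  imports Defs
begin

text \<open>
  Put \<open>W = V\<^sub>1\<^sup>* V\<^sub>2\<close>. Freeness makes all nonzero moments of \<open>W\<close> vanish, and
  \<open>T(z) = V\<^sub>1 (\<alpha> - \<beta> W)\<close> with \<open>\<alpha> = (1 + z) (a/(1-a))\<^sup>1\<^sup>/\<^sup>2\<close> and
  \<open>\<beta> = z (b/(1-b))\<^sup>1\<^sup>/\<^sup>2\<close>. By traciality the outer factor \<open>V\<^sub>1\<close> disappears from
  \<open>d(z,w)\<close>, so that only the commutative algebra generated by the Haar unitary \<open>W\<close> matters.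
  There \<open>1 + T(z)\<^sup>* T(z)\<close> factors as \<open>k\<^sub>1 k\<^sub>2 (1 - q W)\<^sup>* (1 - q W)\<close> with \<open>\<bar>q\<bar> < 1\<close>,
  whence its inverse is \<open>(R + R\<^sup>* - 1) / \<rho>(z)\<close> with \<open>R = (1 - q W)\<^sup>-\<^sup>1\<close>. The traces of
  products of two such inverses with \<open>1\<close>, \<open>W\<close>, \<open>W\<^sup>*\<close> follow from \<open>R = 1 + q W R\<close>.
\<close>

section \<open>Bounded operators on a complex Hilbert space\<close>

text \<open>Completing the square: if \<open>v\<close> represents \<open>\<phi>\<close>, then
  \<open>J x = |x - v|^2 - |v|^2\<close>, so \<open>v\<close> is sought as the minimiser of
  \<open>J\<close>. Completeness supplies the limit of a minimising sequence.\<close>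

lemma riesz_representation:
  fixes \<phi> :: "'a::{real_inner,complete_space} \<Rightarrow> real"
  assumes "bounded_linear \<phi>"
  shows "\<exists>v. \<forall>x. \<phi> x = inner x v"
proof -
  interpret bounded_linear \<phi> by fact
  define J where "J x = (norm x)\<^sup>2 - 2 * \<phi> x" for x
  obtain K where K: "\<And>x. norm (\<phi> x) \<le> norm x * K" and "0 \<le> K"
    using nonneg_bounded by blast
  have lower: "- K\<^sup>2 \<le> J x" for x
  proof -
    have "\<phi> x \<le> norm x * K" using K[of x] by simp
    moreover have "0 \<le> (norm x - K)\<^sup>2" by simp
    ultimately show ?thesis unfolding J_def power2_diff by simp
  qed
  define m where "m = (INF x. J x)"
  have bdd: "bdd_below (range J)" using lower by (auto intro!: bdd_belowI)
  have m_le: "m \<le> J x" for x unfolding m_def by (rule cINF_lower[OF bdd]) simp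
  have "\<exists>x. J x < m + inverse (Suc n)" for n
    using cINF_less_iff[OF _ bdd, of "m + inverse (Suc n)"] by (auto simp: m_def)
  then obtain u where u: "\<And>n. J (u n) < m + inverse (real (Suc n))" by metis
  \<comment> \<open>Parallelogram law, with \<open>J\<close> at the midpoint of \<open>x\<close> and
    \<open>y\<close> bounded below by \<open>m\<close>; near-minimisers are therefore close
    together.\<close>
  have par: "(norm (x - y))\<^sup>2 \<le> 2 * J x + 2 * J y - 4 * m" for x y
  proof -
    have "(norm (x - y))\<^sup>2 = 2 * J x + 2 * J y - 4 * J ((1/2) *\<^sub>R (x + y))"
      unfolding J_def power2_norm_eq_inner
      by (simp add: add scaleR inner_add_left inner_add_right inner_diff_left inner_diff_right
          inner_commute algebra_simps)
    then show ?thesis using m_le[of "(1/2) *\<^sub>R (x + y)"] by simp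
  qed
  have "Cauchy u"
  proof (rule metric_CauchyI)
    fix e :: real assume "0 < e"
    \<comment> \<open>Beyond \<open>M\<close> the values of \<open>J\<close> exceed \<open>m\<close>
      by less than \<open>e^2 / 4\<close>, and \<open>par\<close> doubles each of the two
      excesses.\<close>
    then obtain M where M: "inverse (real (Suc M)) < e\<^sup>2 / 4"
      using reals_Archimedean[of "e\<^sup>2 / 4"] by auto
    show "\<exists>M. \<forall>i\<ge>M. \<forall>j\<ge>M. dist (u i) (u j) < e"
    proof (intro exI allI impI)
      fix i j assume "M \<le> i" "M \<le> j"
      then have "inverse (real (Suc i)) \<le> inverse (real (Suc M))"
        "inverse (real (Suc j)) \<le> inverse (real (Suc M))" by auto
      then have "(norm (u i - u j))\<^sup>2 < e\<^sup>2"
        using par[of "u i" "u j"] u[of i] u[of j] M by linarith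
      then show "dist (u i) (u j) < e"
        using \<open>0 < e\<close> by (simp add: dist_norm power2_less_imp_less)
    qed
  qed
  then obtain v where v: "u \<longlonglongrightarrow> v"
    using Cauchy_convergent convergent_def by blast
  have "(\<lambda>n. J (u n)) \<longlonglongrightarrow> J v"
    unfolding J_def by (intro tendsto_intros v tendsto)
  moreover have "(\<lambda>n. m + inverse (real (Suc n))) \<longlonglongrightarrow> m"
    using tendsto_add[OF tendsto_const LIMSEQ_inverse_real_of_nat, of m] by simp
  ultimately have "J v \<le> m"
    by (rule LIMSEQ_le) (use u less_imp_le in blast)
  then have min: "J v \<le> J x" for x using m_le[of x] by simp
  have "\<phi> x = inner x v" for x
  proof (rule ccontr)
    define c where "c = inner x v - \<phi> x"
    assume "\<phi> x \<noteq> inner x v"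
    then have c: "c \<noteq> 0" and "x \<noteq> 0" by (auto simp: c_def zero)
    have *: "J (v + t *\<^sub>R x) = J v + 2 * t * c + t\<^sup>2 * (norm x)\<^sup>2" for t
      unfolding J_def c_def power2_norm_eq_inner
      by (simp add: add scaleR inner_add_left inner_add_right inner_commute
          power2_eq_square algebra_simps)
    \<comment> \<open>Minimiser in \<open>t\<close> of the quadratic
      \<open>2 * t * c + t^2 * |x|^2\<close>; it pushes \<open>J\<close> strictly below
      \<open>J v\<close>.\<close>
    define t where "t = - c / (norm x)\<^sup>2"
    have "2 * t * c + t\<^sup>2 * (norm x)\<^sup>2 = - (c\<^sup>2 / (norm x)\<^sup>2)"
      using \<open>x \<noteq> 0\<close> by (simp add: t_def power2_eq_square field_simps)
    moreover have "c\<^sup>2 / (norm x)\<^sup>2 > 0" using c \<open>x \<noteq> 0\<close> by simp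
    ultimately show False using min[of "v + t *\<^sub>R x"] * by simp
  qed
  then show ?thesis by blast
qed

subsection \<open>Adjoints\<close>

lemma bop_apply_simps [simp]:
  "bop_apply 0 x = 0" "bop_apply 1 x = x"
  "bop_apply (A + B) x = bop_apply A x + bop_apply B x"
  "bop_apply (A - B) x = bop_apply A x - bop_apply B x"
  "bop_apply (- A) x = - bop_apply A x"
  "bop_apply (A * B) x = bop_apply A (bop_apply B x)"
  by (transfer, simp add: blinfun.add_left blinfun.diff_left blinfun.minus_left)+

declare bop_apply_scaleC [simp]

lemma bop_apply_scaleC_right: "bop_apply A (c *\<^sub>C x) = c *\<^sub>C bop_apply A x"
  by transfer simp

lemma bop_apply_diff_right: "bop_apply A (x - y) = bop_apply A x - bop_apply A y"
  by transfer (rule blinfun.diff_right)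

lemma ex_bop:
  fixes f :: "'h::chilbert_space \<Rightarrow> 'h"
  assumes add: "\<And>x y. f (x + y) = f x + f y" and scale: "\<And>c x. f (c *\<^sub>C x) = c *\<^sub>C f x"
    and bound: "\<And>x. norm (f x) \<le> norm x * K"
  shows "\<exists>B. \<forall>x. bop_apply B x = f x"
proof -
  have "bounded_linear f"
    by (rule bounded_linear_intro[of f K]) (auto simp: add bound scale scaleC_of_real[symmetric])
  then have eq: "blinfun_apply (Blinfun f) = f" by (rule bounded_linear_Blinfun_apply)
  then have "blinfun_of_bop (Abs_bop (Blinfun f)) = Blinfun f"
    by (intro Abs_bop_inverse) (simp add: scale)
  then have "\<forall>x. bop_apply (Abs_bop (Blinfun f)) x = f x"
    by (simp add: bop_apply.rep_eq eq)
  then show ?thesis by blast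
qed

lemma cinner_add_right: "cinner x (y + z) = cinner x y + cinner x (z::'h::chilbert_space)"
  using cinner_add_left[of y z x] by (metis cinner_commute complex_cnj_add)

lemma cinner_scaleC_right: "cinner x (c *\<^sub>C y) = cnj c * cinner x (y::'h::chilbert_space)"
  using cinner_scaleC_left[of c y x] by (metis cinner_commute complex_cnj_mult)

lemma cinner_eqI:
  fixes x y :: "'h::chilbert_space"
  assumes "\<And>z. cinner z x = cinner z y"
  shows "x = y"
proof -
  have "inner (x - y) x = inner (x - y) y" using assms[of "x - y"] Re_cinner by metis
  then have "inner (x - y) (x - y) = 0" by (simp add: inner_diff_right)
  then show ?thesis by simp
qed

lemma norm_scaleC: "norm (c *\<^sub>C x) = cmod c * norm (x::'h::chilbert_space)"
proof -
  have "cinner (c *\<^sub>C x) (c *\<^sub>C x) = c * cnj c * cinner x x"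
    by (simp add: cinner_scaleC_left cinner_scaleC_right ac_simps)
  then have "inner (c *\<^sub>C x) (c *\<^sub>C x) = Re (c * cnj c * cinner x x)"
    by (metis Re_cinner)
  also have "\<dots> = (cmod c)\<^sup>2 * inner x x"
    by (simp add: complex_norm_square[symmetric] Re_cinner)
  finally have "(norm (c *\<^sub>C x))\<^sup>2 = (cmod c * norm x)\<^sup>2"
    by (simp add: power2_norm_eq_inner power_mult_distrib)
  then show ?thesis by (simp add: power2_eq_iff_nonneg)
qed

text \<open>Riesz representation for the real inner product gives \<open>f y\<close> for each
  \<open>y\<close>. A vector is determined by its inner products, which makes \<open>f\<close>
  complex linear, and Cauchy-Schwarz at \<open>f x\<close> transfers the bound of \<open>A\<close>
  to \<open>f\<close>.\<close>

lemma ex_adjoint: "\<exists>B. \<forall>x y. cinner (bop_apply A x) y = cinner x (bop_apply B y)"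
proof -
  have bl: "bounded_linear (bop_apply A)"
    unfolding bop_apply.rep_eq by (rule blinfun.bounded_linear_right)
  obtain K where K: "\<And>x. norm (bop_apply A x) \<le> norm x * K" and K0: "0 \<le> K"
    using bounded_linear.nonneg_bounded[OF bl] by blast
  have "\<exists>v. \<forall>x. inner (bop_apply A x) y = inner x v" for y
    by (rule riesz_representation)
      (rule bounded_linear_compose[OF bounded_linear_inner_left bl])
  then obtain f where f: "\<And>x y. inner (bop_apply A x) y = inner x (f y)" by metis
  have f': "cinner (bop_apply A x) y = cinner x (f y)" for x y
  proof (rule complex_eqI)
    show "Re (cinner (bop_apply A x) y) = Re (cinner x (f y))" using f by (simp add: Re_cinner)
    \<comment> \<open>Real parts at \<open>\<i> *\<^sub>C x\<close> are, up to sign, imaginary parts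
      at \<open>x\<close>.\<close>
    have "Re (cinner (bop_apply A (\<i> *\<^sub>C x)) y) = Re (cinner (\<i> *\<^sub>C x) (f y))"
      using f by (simp add: Re_cinner)
    then show "Im (cinner (bop_apply A x) y) = Im (cinner x (f y))"
      by (simp add: bop_apply_scaleC_right cinner_scaleC_left)
  qed
  have "\<exists>B. \<forall>x. bop_apply B x = f x"
  proof (rule ex_bop)
    show "f (x + y) = f x + f y" for x y
      by (rule cinner_eqI) (simp add: cinner_add_right f'[symmetric])
    show "f (c *\<^sub>C x) = c *\<^sub>C f x" for c x
      by (rule cinner_eqI) (simp add: cinner_scaleC_right f'[symmetric])
    show "norm (f x) \<le> norm x * K" for x
    proof -
      have "norm (f x) * norm (f x) = inner (bop_apply A (f x)) x"
        by (simp add: f power2_norm_eq_inner[symmetric] power2_eq_square)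
      also have "\<dots> \<le> norm (bop_apply A (f x)) * norm x" by (rule norm_cauchy_schwarz)
      also have "\<dots> \<le> norm (f x) * K * norm x" by (intro mult_right_mono K) simp
      finally have "norm (f x) * norm (f x) \<le> norm (f x) * (norm x * K)" by (simp add: ac_simps)
      then show ?thesis
        using K0 by (cases "norm (f x) = 0") (auto simp: mult_le_cancel_left)
    qed
  qed
  then show ?thesis using f' by metis
qed

lemma star_eqI:
  assumes "\<And>x y. cinner (bop_apply A x) y = cinner x (bop_apply B y)"
  shows "star A = B"
  unfolding star_def
proof (rule the_equality)
  fix C assume "\<forall>x y. cinner (bop_apply A x) y = cinner x (bop_apply C y)"
  then have "cinner x (bop_apply C y) = cinner x (bop_apply B y)" for x y using assms by simp
  then show "C = B" by (intro bop_eqI cinner_eqI)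
qed (use assms in blast)

lemma cinner_star: "cinner (bop_apply A x) y = cinner x (bop_apply (star A) y)"
  using ex_adjoint[of A] star_eqI[of A] by metis

lemma cinner_star': "cinner (bop_apply (star A) x) y = cinner x (bop_apply A y)"
  by (metis cinner_star cinner_commute)

lemma star_star [simp]: "star (star A) = A"
  by (rule star_eqI) (rule cinner_star')

lemma star_one [simp]: "star 1 = 1"
  by (rule star_eqI) simp

lemma star_add: "star (A + B) = star A + star B"
  by (rule star_eqI) (simp add: cinner_add_left cinner_add_right cinner_star)

lemma star_scaleC: "star (c *\<^sub>C A) = cnj c *\<^sub>C star A"
  by (rule star_eqI) (simp add: cinner_scaleC_left cinner_scaleC_right cinner_star)

lemma star_mult: "star (A * B) = star B * star A"
  by (rule star_eqI) (simp add: cinner_star)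

lemma bop_scaleC_simps:
  fixes A B :: "'h::chilbert_space bop"
  shows "c *\<^sub>C (A + B) = c *\<^sub>C A + c *\<^sub>C B" "(c + d) *\<^sub>C A = c *\<^sub>C A + d *\<^sub>C A"
    "c *\<^sub>C d *\<^sub>C A = (c * d) *\<^sub>C A"
    "(c *\<^sub>C A) * B = c *\<^sub>C (A * B)" "A * (c *\<^sub>C B) = c *\<^sub>C (A * B)"
    "c *\<^sub>C (A - B) = c *\<^sub>C A - c *\<^sub>C B" "(c - d) *\<^sub>C A = c *\<^sub>C A - d *\<^sub>C A"
    "c *\<^sub>C (- A) = - (c *\<^sub>C A)"
proof -
  show "(c - d) *\<^sub>C A = c *\<^sub>C A - d *\<^sub>C A"
    by (intro bop_eqI) (simp add: eq_diff_eq scaleC_add_left[symmetric])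
qed (rule bop_eqI, simp add: scaleC_add_right scaleC_add_left scaleC_scaleC bop_apply_scaleC_right
    scaleC_diff_right scaleC_minus_right)+

lemma bop_scaleC_one [simp]: "1 *\<^sub>C (A :: 'h::chilbert_space bop) = A"
  by (rule bop_eqI) (use scaleC_of_real[of 1] in simp)

lemma bop_scaleC_zero [simp]: "0 *\<^sub>C (A :: 'h::chilbert_space bop) = 0"
  by (rule bop_eqI) (use scaleC_of_real[of 0] in simp)

lemma bop_uminus_eq_scaleC: "- (A :: 'h::chilbert_space bop) = (-1) *\<^sub>C A"
  using bop_scaleC_simps(7)[of 0 1 A] by simp

lemma star_minus: "star (- A) = - star A"
  by (simp add: bop_uminus_eq_scaleC star_scaleC)

lemma star_diff: "star (A - B) = star A - star B"
  using star_add[of A "- B"] by (simp add: star_minus)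

lemmas star_simps = star_add star_diff star_minus star_mult star_scaleC

subsection \<open>Inverses and square roots\<close>

lemma inverse_unique_ring:
  fixes A :: "'a::ring_1"
  assumes "B * A = 1" "A * C = 1"
  shows "B = C"
  by (metis assms mult.assoc mult_1_left mult_1_right)

lemma op_inv_eqI:
  assumes "A * B = 1" "B * A = 1"
  shows "op_inv A = B"
  unfolding op_inv_def by (rule the_equality) (use assms inverse_unique_ring in blast)+

lemma op_inv_scalar:
  assumes "c \<noteq> 0"
  shows "op_inv (c *\<^sub>C 1 :: 'h::chilbert_space bop) = inverse c *\<^sub>C 1"
  by (rule op_inv_eqI) (use assms in \<open>simp_all add: bop_scaleC_simps\<close>)

text \<open>The content is uniqueness. For a positive root \<open>B\<close> and
  \<open>s = sqrt c\<close>, \<open>(B + s) (B - s) = 0\<close>, and \<open>B + s\<close> is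
  injective because its quadratic form at \<open>y\<close> is at least
  \<open>s |y|^2\<close>.\<close>

lemma op_sqrt_scalar:
  assumes "0 < c"
  shows "op_sqrt (complex_of_real c *\<^sub>C 1 :: 'h::chilbert_space bop) = complex_of_real (sqrt c) *\<^sub>C 1"
  unfolding op_sqrt_def
proof (rule the_equality)
  let ?s = "complex_of_real (sqrt c)"
  have ss: "?s * ?s = complex_of_real c"
    using assms by (simp add: of_real_mult[symmetric] del: of_real_mult)
  have pos: "0 \<le> Re (cinner (?s *\<^sub>C x) x)" for x :: 'h
    using assms by (simp add: cinner_scaleC_left Re_cinner)
  then show "positive_op (?s *\<^sub>C 1 :: 'h bop)
      \<and> (?s *\<^sub>C 1) * (?s *\<^sub>C 1) = complex_of_real c *\<^sub>C (1 :: 'h bop)"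
    by (simp add: positive_op_def star_simps bop_scaleC_simps ss)
  fix B :: "'h bop" assume B: "positive_op B \<and> B * B = complex_of_real c *\<^sub>C 1"
  have "(B + ?s *\<^sub>C 1) * (B - ?s *\<^sub>C 1) = 0"
    using B by (simp add: algebra_simps bop_scaleC_simps ss)
  then have zero: "bop_apply (B + ?s *\<^sub>C 1) (bop_apply (B - ?s *\<^sub>C 1) x) = 0" for x
    by (metis bop_apply_simps(1,6))
  have "bop_apply (B - ?s *\<^sub>C 1) x = 0" for x
  proof -
    let ?y = "bop_apply (B - ?s *\<^sub>C 1) x"
    have "Re (cinner (bop_apply (B + ?s *\<^sub>C 1) ?y) ?y) = 0"
      unfolding zero by (simp add: Re_cinner)
    moreover have "Re (cinner (bop_apply (B + ?s *\<^sub>C 1) ?y) ?y)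
        = Re (cinner (bop_apply B ?y) ?y) + sqrt c * inner ?y ?y"
      by (simp only: bop_apply_simps bop_apply_scaleC cinner_add_left cinner_scaleC_left
          plus_complex.sel Re_cinner) (simp add: Re_cinner)
    ultimately have "sqrt c * inner ?y ?y \<le> 0" using B
      unfolding positive_op_def
      by (metis add_increasing linorder_not_le order_less_irrefl)
    then have "inner ?y ?y \<le> 0" using assms by (simp add: mult_le_0_iff)
    then show ?thesis by (metis inner_eq_zero_iff inner_ge_zero order_antisym)
  qed
  then show "B = ?s *\<^sub>C 1" by (intro bop_eqI) simp
qed

lemma norm_isometry:
  assumes "star U * U = 1"
  shows "norm (bop_apply U x) = norm x"
proof -
  have "cinner (bop_apply U x) (bop_apply U x) = cinner x (bop_apply (star U * U) x)"
    by (simp add: cinner_star)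
  then have "inner (bop_apply U x) (bop_apply U x) = inner x x"
    by (metis Re_cinner assms bop_apply_simps(2))
  then show ?thesis by (simp add: norm_eq)
qed

text \<open>The value of the inverse at \<open>y\<close> is the fixed point of the contraction
  \<open>x \<mapsto> y + q U x\<close>.\<close>

lemma ex_resolvent:
  assumes U: "star U * U = 1" and q: "cmod q < 1"
  shows "\<exists>X. (1 - q *\<^sub>C U) * X = 1 \<and> X * (1 - q *\<^sub>C U) = 1"
proof -
  let ?q = "cmod q" and ?U = "\<lambda>x. q *\<^sub>C bop_apply U x"
  have nU: "norm (?U x) = ?q * norm x" for x by (simp add: norm_scaleC norm_isometry[OF U])
  have lin: "?U (x - y) = ?U x - ?U y" "?U (x + y) = ?U x + ?U y" "?U (c *\<^sub>C x) = c *\<^sub>C ?U x" for x y c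
    by (simp_all add: bop_apply_diff_right bop_apply_add_right bop_apply_scaleC_right
        scaleC_diff_right scaleC_add_right scaleC_scaleC mult.commute)
  have ex1: "\<exists>!x. y + ?U x = x" for y
  proof (rule banach_fix_type[of ?q])
    show "\<forall>x x'. dist (y + ?U x) (y + ?U x') \<le> ?q * dist x x'"
      by (simp add: dist_norm lin(1)[symmetric] nU)
  qed (use q in auto)
  then obtain f where f: "\<And>y. y + ?U (f y) = f y" by metis
  \<comment> \<open>Uniqueness of the fixed point gives additivity and homogeneity of
    \<open>f\<close>, and at the end the left inverse.\<close>
  have uniq: "x = f y" if "y + ?U x = x" for x y using ex1[of y] that f[of y] by blast
  have "\<exists>B. \<forall>x. bop_apply B x = f x"
  proof (rule ex_bop)
    show "f (x + y) = f x + f y" for x y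
    proof (rule uniq[symmetric])
      show "x + y + ?U (f x + f y) = f x + f y"
        using f[of x] f[of y] unfolding lin(2) by (metis add.assoc add.left_commute)
    qed
    show "f (c *\<^sub>C x) = c *\<^sub>C f x" for c x
    proof (rule uniq[symmetric])
      show "c *\<^sub>C x + ?U (c *\<^sub>C f x) = c *\<^sub>C f x"
        unfolding lin(3) scaleC_add_right[symmetric] f ..
    qed
    show "norm (f x) \<le> norm x * (1 / (1 - ?q))" for x
    proof -
      have "norm (f x) \<le> norm x + ?q * norm (f x)"
        using norm_triangle_ineq[of x "?U (f x)"] by (simp add: f nU)
      then show ?thesis using q by (simp add: field_simps)
    qed
  qed
  then obtain X where X: "\<And>x. bop_apply X x = f x" by blast
  have "(1 - q *\<^sub>C U) * X = 1"
    by (rule bop_eqI) (use f in \<open>simp add: X diff_eq_eq\<close>)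
  moreover have "X * (1 - q *\<^sub>C U) = 1"
  proof (rule bop_eqI)
    fix x
    have "x - ?U x + ?U x = x" by simp
    then have "x = f (x - ?U x)" by (rule uniq)
    then show "bop_apply (X * (1 - q *\<^sub>C U)) x = bop_apply 1 x" by (simp add: X)
  qed
  ultimately show ?thesis by blast
qed

section \<open>States on algebras of operators\<close>

text \<open>These closure properties hold in every commutant of a star-closed set.
  \<open>inverse_mem\<close> takes the place of norm closure: it puts resolvents into the
  algebra.\<close>

locale operator_algebra =
  fixes M :: "'h::chilbert_space bop set"
  assumes one_mem: "1 \<in> M"
    and add_mem: "A \<in> M \<Longrightarrow> B \<in> M \<Longrightarrow> A + B \<in> M"
    and mult_mem: "A \<in> M \<Longrightarrow> B \<in> M \<Longrightarrow> A * B \<in> M"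
    and scaleC_mem: "A \<in> M \<Longrightarrow> c *\<^sub>C A \<in> M"
    and star_mem: "A \<in> M \<Longrightarrow> star A \<in> M"
    and inverse_mem: "A \<in> M \<Longrightarrow> A * B = 1 \<Longrightarrow> B * A = 1 \<Longrightarrow> B \<in> M"
begin

lemma uminus_mem: "A \<in> M \<Longrightarrow> - A \<in> M"
  by (simp add: bop_uminus_eq_scaleC scaleC_mem)

lemma diff_mem: "A \<in> M \<Longrightarrow> B \<in> M \<Longrightarrow> A - B \<in> M"
  using add_mem[OF _ uminus_mem, of A B] by simp

lemma power_mem: "A \<in> M \<Longrightarrow> A ^ n \<in> M"
  by (induction n) (auto simp: one_mem mult_mem)

lemmas mem = one_mem add_mem mult_mem scaleC_mem star_mem uminus_mem diff_mem power_mem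

end

section \<open>Commutants and von Neumann algebras\<close>

lemma operator_algebra_commutant:
  assumes "\<And>A. A \<in> S \<Longrightarrow> star A \<in> S"
  shows "operator_algebra (commutant S)"
proof
  fix A B assume A: "A \<in> commutant S"
  show "A + B \<in> commutant S" "A * B \<in> commutant S" if "B \<in> commutant S"
    using A that by (auto simp: commutant_def algebra_simps) (metis mult.assoc)
  show "c *\<^sub>C A \<in> commutant S" for c
    using A by (auto simp: commutant_def bop_scaleC_simps)
  show "star A \<in> commutant S"
    unfolding commutant_def
  proof (intro CollectI ballI)
    fix C assume "C \<in> S"
    then have "A * star C = star C * A" using A assms by (auto simp: commutant_def)
    then have "star (A * star C) = star (star C * A)" by simp
    then show "star A * C = C * star A" by (simp add: star_mult)
  qed
  assume inv: "A * B = 1" "B * A = 1"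
  show "B \<in> commutant S"
    unfolding commutant_def
  proof (intro CollectI ballI)
    fix C assume "C \<in> S"
    then have AC: "A * C = C * A" using A by (auto simp: commutant_def)
    have "B * C = B * C * (A * B)" by (simp add: inv)
    also have "\<dots> = B * (A * C) * B" by (simp add: AC mult.assoc)
    also have "\<dots> = C * B" using inv by (simp add: mult.assoc[symmetric])
    finally show "B * C = C * B" .
  qed
qed (simp add: commutant_def)

lemma commutant_antimono: "S \<subseteq> S' \<Longrightarrow> commutant S' \<subseteq> commutant S"
  by (auto simp: commutant_def)

lemma star_commutant:
  assumes "\<And>A. A \<in> S \<Longrightarrow> star A \<in> S" "A \<in> commutant S"
  shows "star A \<in> commutant S"
  using operator_algebra.star_mem[OF operator_algebra_commutant] assms by blast

lemma operator_algebra_vN: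
  assumes "vN_algebra N"
  shows "operator_algebra N"
proof -
  have "operator_algebra (commutant (commutant N))"
    by (intro operator_algebra_commutant star_commutant) (use assms in \<open>auto simp: vN_algebra_def\<close>)
  then show ?thesis using assms by (simp add: vN_algebra_def)
qed

lemma vN_generated_mem: "U \<in> vN_generated {U}" "star U \<in> vN_generated {U}"
  by (auto simp: vN_generated_def vN_algebra_def)

section \<open>States: adjoints, Cauchy-Schwarz and resolvents\<close>

text \<open>Traciality is added only in \<open>trace_algebra\<close>, so that the ambient algebra
  and its commutative subalgebra share these facts.\<close>

locale state_algebra = operator_algebra M for M :: "'h::chilbert_space bop set" +
  fixes \<tau> :: "'h bop \<Rightarrow> complex"
  assumes tau_add: "A \<in> M \<Longrightarrow> B \<in> M \<Longrightarrow> \<tau> (A + B) = \<tau> A + \<tau> B"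
    and tau_scaleC: "A \<in> M \<Longrightarrow> \<tau> (c *\<^sub>C A) = c * \<tau> A"
    and tau_pos: "A \<in> M \<Longrightarrow> Im (\<tau> (star A * A)) = 0 \<and> 0 \<le> Re (\<tau> (star A * A))"
    and tau_one: "\<tau> 1 = 1"
begin

lemma tau_uminus: "A \<in> M \<Longrightarrow> \<tau> (- A) = - \<tau> A"
  by (simp add: bop_uminus_eq_scaleC tau_scaleC)

lemma tau_diff: "A \<in> M \<Longrightarrow> B \<in> M \<Longrightarrow> \<tau> (A - B) = \<tau> A - \<tau> B"
  using tau_add[of A "- B"] by (simp add: tau_uminus mem)

lemmas tau_simps = tau_add tau_diff tau_uminus tau_scaleC tau_one

lemma tau_star:
  assumes "A \<in> M"
  shows "\<tau> (star A) = cnj (\<tau> A)"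
proof -
  \<comment> \<open>Positivity at \<open>A + c 1\<close>; the choices \<open>c = 1\<close> and
    \<open>c = \<i>\<close> separate the imaginary and real parts of
    \<open>\<tau> (star A) - cnj (\<tau> A)\<close>.\<close>
  have *: "Im (\<tau> (star A * A) + c * cnj c + c * \<tau> (star A) + cnj c * \<tau> A) = 0" for c
    using tau_pos[of "A + c *\<^sub>C 1"] assms
    by (simp add: star_simps algebra_simps bop_scaleC_simps tau_simps mem)
  show ?thesis
    using *[of 1] *[of \<i>] tau_pos[OF assms] by (simp add: complex_eq_iff)
qed

text \<open>Cauchy-Schwarz against the identity: the variance of \<open>A\<close> about its mean
  \<open>\<tau> A\<close> is nonnegative.\<close>

lemma norm_tau_le:
  assumes "A \<in> M"
  shows "(cmod (\<tau> A))\<^sup>2 \<le> Re (\<tau> (star A * A))"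
proof -
  let ?c = "\<tau> A"
  have "0 \<le> Re (\<tau> (star (A - ?c *\<^sub>C 1) * (A - ?c *\<^sub>C 1)))"
    by (intro conjunct2[OF tau_pos] mem assms)
  also have "star (A - ?c *\<^sub>C 1) * (A - ?c *\<^sub>C 1)
      = star A * A - ?c *\<^sub>C star A - cnj ?c *\<^sub>C A + (cnj ?c * ?c) *\<^sub>C 1"
    by (simp add: star_simps left_diff_distrib right_diff_distrib bop_scaleC_simps mult.commute)
  also have "\<tau> \<dots> = \<tau> (star A * A) - ?c * cnj ?c"
    using assms by (simp add: tau_simps mem tau_star)
  finally show ?thesis unfolding cmod_power2 by (simp add: power2_eq_square)
qed

end

text \<open>Passing from moments to the resolvent needs no series: \<open>t\<^sub>m = \<tau> (W\<^sup>m X A)\<close> satisfies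
  \<open>t\<^sub>m = q t\<^sub>m\<^sub>+\<^sub>1\<close> and is bounded in \<open>m\<close>.\<close>

lemma (in state_algebra) resolvent_moment:
  assumes W: "W \<in> M" "star W * W = 1" and X: "X \<in> M" "X = 1 + q *\<^sub>C (W * X)" and q: "cmod q < 1"
    and A: "A \<in> M" "\<And>m. 1 \<le> m \<Longrightarrow> \<tau> (W ^ m * A) = 0" and m: "1 \<le> m"
  shows "\<tau> (W ^ m * (X * A)) = 0"
proof -
  define t where "t m = \<tau> (W ^ m * (X * A))" for m
  have iso: "star (W ^ m) * W ^ m = 1" for m
  proof (induction m)
    case (Suc m)
    have "star (W ^ Suc m) * W ^ Suc m = star (W ^ m) * (star W * W) * W ^ m"
      by (simp add: star_mult mult.assoc)
    then show ?case using Suc W by simp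
  qed simp
  \<comment> \<open>The summand \<open>1\<close> of \<open>X = 1 + q W X\<close> contributes
    \<open>\<tau> (W ^ m * A)\<close>, which vanishes by hypothesis.\<close>
  have step: "t m = q * t (Suc m)" if "1 \<le> m" for m
  proof -
    have "W ^ m * (X * A) = W ^ m * (1 + q *\<^sub>C (W * X)) * A"
      using arg_cong[OF X(2), of "\<lambda>B. W ^ m * B * A"] by (simp only: mult.assoc)
    also have "\<dots> = W ^ m * A + q *\<^sub>C (W ^ Suc m * (X * A))"
      by (simp add: algebra_simps bop_scaleC_simps power_Suc2 del: power_Suc)
    finally show ?thesis
      unfolding t_def by (simp add: tau_simps mem W X(1) A(1) A(2)[OF that] del: power_Suc)
  qed
  have iter: "t m = q ^ n * t (m + n)" for n
  proof (induction n)
    case (Suc n)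
    then show ?case using step[of "m + n"] m by (simp del: power_Suc add: power_Suc2)
  qed simp
  \<comment> \<open>A bound independent of the exponent, since powers of the isometry
    \<open>W\<close> drop out of \<open>star B * B\<close> for
    \<open>B = W ^ n * (X * A)\<close>.\<close>
  define K where "K = sqrt (Re (\<tau> (star (X * A) * (X * A))))"
  have bound: "cmod (t n) \<le> K" for n
  proof -
    have "star (W ^ n * (X * A)) * (W ^ n * (X * A)) = star (X * A) * (star (W ^ n) * W ^ n) * (X * A)"
      by (simp add: star_mult mult.assoc)
    then have "(cmod (t n))\<^sup>2 \<le> Re (\<tau> (star (X * A) * (X * A)))"
      using norm_tau_le[of "W ^ n * (X * A)"] by (simp add: t_def mem W X(1) A iso)
    then show ?thesis unfolding K_def by (rule real_le_rsqrt)
  qed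
  have "cmod (t m) \<le> cmod q ^ n * K" for n
    unfolding iter[of n] norm_mult norm_power by (intro mult_left_mono bound) simp
  moreover have "(\<lambda>n. cmod q ^ n * K) \<longlonglongrightarrow> 0"
    using q by (intro tendsto_mult_left_zero LIMSEQ_power_zero) simp
  ultimately have "cmod (t m) \<le> 0" by (intro LIMSEQ_le_const[where a = "cmod (t m)"]) blast+
  then show ?thesis by (simp add: t_def)
qed

section \<open>Resolvents and Poisson kernels of a Haar unitary\<close>

text \<open>An algebraic model of functions on the circle under Haar measure, with \<open>W\<close>
  as the coordinate function. Negative moments vanish by \<open>tau_star\<close>, and
  \<open>W * star W = 1\<close> comes from commutativity.\<close>

locale haar_algebra = state_algebra M \<tau>
  for M :: "'h::chilbert_space bop set" and \<tau> +
  fixes W :: "'h bop"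
  assumes commute: "A \<in> M \<Longrightarrow> B \<in> M \<Longrightarrow> A * B = B * A"
    and W_mem: "W \<in> M" and unitary: "star W * W = 1"
    and moment: "1 \<le> m \<Longrightarrow> \<tau> (W ^ m) = 0"
begin

text \<open>On the circle this is \<open>1 / (1 - q \<zeta>)\<close>, the geometric series in
  \<open>q \<zeta>\<close>, when \<open>cmod q < 1\<close>.\<close>

definition R :: "complex \<Rightarrow> 'h bop" where
  "R q = op_inv (1 - q *\<^sub>C W)"

lemma R_inverse:
  assumes "cmod q < 1"
  shows "(1 - q *\<^sub>C W) * R q = 1" "R q * (1 - q *\<^sub>C W) = 1"
  using ex_resolvent[OF unitary assms] op_inv_eqI by (auto simp: R_def)

lemma R_mem: "cmod q < 1 \<Longrightarrow> R q \<in> M"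
  by (rule inverse_mem[OF _ R_inverse]) (simp_all add: mem W_mem)

lemma R_eq:
  assumes "cmod q < 1"
  shows "R q = 1 + q *\<^sub>C (W * R q)" "star (R q) = 1 + cnj q *\<^sub>C (star W * star (R q))"
proof -
  show "R q = 1 + q *\<^sub>C (W * R q)"
    using R_inverse(1)[OF assms] by (simp add: algebra_simps bop_scaleC_simps)
  then have "star (R q) = star (1 + q *\<^sub>C (W * R q))" by simp
  also have "\<dots> = 1 + cnj q *\<^sub>C (star W * star (R q))"
    using commute[of "star (R q)" "star W"] by (simp add: star_simps mem W_mem R_mem assms)
  finally show "star (R q) = 1 + cnj q *\<^sub>C (star W * star (R q))" .
qed

lemma W_star: "W * star W = 1"
  using unitary commute[OF W_mem star_mem[OF W_mem]] by simp

lemma W_cancel: "star W * (W * A) = A" "W * (star W * A) = A"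
  by (simp_all add: mult.assoc[symmetric] unitary W_star)

text \<open>These are Fourier coefficients of products of geometric series. Each is computed by
  substituting \<open>R = 1 + q W R\<close>, or its adjoint, for one factor and cancelling
  \<open>W\<close> against \<open>star W\<close>.\<close>

lemma R_moments:
  assumes q: "cmod q < 1" and p: "cmod p < 1"
  shows "\<tau> (R q) = 1" "\<tau> (W * R q) = 0" "\<tau> (star W * R q) = q"
    "\<tau> (R q * R p) = 1" "\<tau> (W * (R q * R p)) = 0" "\<tau> (star W * (R q * R p)) = q + p"
    "\<tau> (star (R p) * R q) = 1 / (1 - q * cnj p)"
    "\<tau> (W * (star (R p) * R q)) = cnj p / (1 - q * cnj p)"
    "\<tau> (star W * (star (R p) * R q)) = q / (1 - q * cnj p)"
proof -
  note [simp] = mem W_mem R_mem q p tau_simps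
  have W1: "\<tau> W = 0" using moment[of 1] by simp
  then have W1': "\<tau> (star W) = 0" by (simp add: tau_star)
  have zero: "\<tau> (W ^ m * (R q * A)) = 0"
    if "A \<in> M" "\<And>m. 1 \<le> m \<Longrightarrow> \<tau> (W ^ m * A) = 0" "1 \<le> m" "cmod q < 1" for A m q
    by (rule resolvent_moment[OF W_mem unitary _ R_eq(1)]) (use that in simp_all)
  have R0: "\<tau> (W ^ m * R q) = 0" if "1 \<le> m" "cmod q < 1" for m q
    using zero[of 1 m q] that moment by simp
  have WR: "\<tau> (W * R q) = 0" if "cmod q < 1" for q using R0[of 1] that by simp
  have R: "\<tau> (R q) = 1" if "cmod q < 1" for q
    by (subst R_eq(1)) (simp_all add: WR that)
  show "\<tau> (R q) = 1" "\<tau> (W * R q) = 0" by (simp_all add: R WR)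
  have W'R: "\<tau> (star W * R q) = q" if "cmod q < 1" for q
    by (subst R_eq(1)) (simp_all add: R that distrib_left bop_scaleC_simps W_cancel W1')
  show "\<tau> (star W * R q) = q" by (simp add: W'R)
  show WRR: "\<tau> (W * (R q * R p)) = 0" using zero[of "R p" 1 q] R0[of _ p] by simp
  have expand: "R q * A = A + q *\<^sub>C (W * (R q * A))" for A
    using arg_cong[OF R_eq(1)[OF q], of "\<lambda>B. B * A"]
    by (simp add: distrib_right bop_scaleC_simps mult.assoc)
  show RR: "\<tau> (R q * R p) = 1"
    by (subst expand) (simp add: WRR R)
  show "\<tau> (star W * (R q * R p)) = q + p"
    by (subst expand) (simp add: distrib_left bop_scaleC_simps W_cancel W'R RR)
  let ?S = "star (R p)"
  have S: "\<tau> ?S = 1" by (simp add: tau_star R)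
  have W'S: "\<tau> (star W * ?S) = 0"
    using WR[OF p] tau_star[of "W * R p"] commute[of ?S "star W"] by (simp add: star_mult)
  have SR: "?S * R q = R q * ?S" by (rule commute) simp_all
  have eq1: "?S * R q = ?S + q *\<^sub>C (W * (?S * R q))"
    unfolding SR by (rule expand)
  have expand': "?S * A = A + cnj p *\<^sub>C (star W * (?S * A))" for A
    using arg_cong[OF R_eq(2)[OF p], of "\<lambda>B. B * A"]
    by (simp add: distrib_right bop_scaleC_simps mult.assoc)
  \<comment> \<open>Expanding \<open>R q\<close> gives
    \<open>\<tau> (star W * (?S * R q)) = q * m\<close>; expanding \<open>?S\<close> then gives a
    linear equation for \<open>m\<close>.\<close>
  define m where "m = \<tau> (?S * R q)"
  have "\<tau> (star W * (?S * R q)) = q * m"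
    by (subst eq1) (simp add: distrib_left bop_scaleC_simps W_cancel W'S m_def)
  then have m': "\<tau> (star W * (?S * R q)) = q * m" .
  have "m = 1 + cnj p * (q * m)"
    unfolding m_def by (subst expand') (simp add: R m'[unfolded m_def])
  moreover have "\<tau> (W * (?S * R q)) = cnj p * m"
    by (subst expand') (simp add: distrib_left bop_scaleC_simps W_cancel WR m_def)
  moreover have "1 - q * cnj p \<noteq> 0"
  proof
    assume "1 - q * cnj p = 0"
    then have "cmod (q * cnj p) = 1" by simp
    moreover have "cmod q * cmod p < 1 * 1" using q p by (intro mult_strict_mono) auto
    ultimately show False by (simp add: norm_mult)
  qed
  ultimately have "m = 1 / (1 - q * cnj p)" "\<tau> (W * (?S * R q)) = cnj p * m"
    by (simp_all add: field_simps)
  then show "\<tau> (?S * R q) = 1 / (1 - q * cnj p)"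
    "\<tau> (W * (?S * R q)) = cnj p / (1 - q * cnj p)" "\<tau> (star W * (?S * R q)) = q / (1 - q * cnj p)"
    using m' by (simp_all add: m_def)
qed

text \<open>The Poisson kernel: on the circle,
  \<open>(1 - |q|^2) / |1 - q \<zeta>|^2\<close>.\<close>

definition G :: "complex \<Rightarrow> 'h bop" where
  "G q = R q + star (R q) - 1"

lemma G_mem: "cmod q < 1 \<Longrightarrow> G q \<in> M"
  by (simp add: G_def mem R_mem)

text \<open>With \<open>A = 1 - q W\<close>, commutativity turns the product into
  \<open>star A + A - star A * A\<close>, which is \<open>1 - star (1 - A) * (1 - A)\<close>; here
  \<open>1 - A = q W\<close> is a multiple of a unitary.\<close>

lemma G_inverse:
  assumes q: "cmod q < 1"
  shows "star (1 - q *\<^sub>C W) * (1 - q *\<^sub>C W) * G q = complex_of_real (1 - (cmod q)\<^sup>2) *\<^sub>C 1"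
proof -
  let ?A = "1 - q *\<^sub>C W"
  have A: "?A \<in> M" by (simp add: mem W_mem)
  have 1: "?A * R q = 1" by (rule R_inverse[OF q])
  have 2: "star ?A * star (R q) = 1"
    using arg_cong[OF R_inverse(2)[OF q], of star] by (simp only: star_mult star_one)
  have "star B * B * G q = star B * (B * R q) + B * (star B * star (R q)) - star B * B" if "B \<in> M" for B
    using commute[OF that star_mem[OF that]]
    by (simp add: G_def algebra_simps) (simp add: mult.assoc[symmetric])
  then have "star ?A * ?A * G q = star ?A * (?A * R q) + ?A * (star ?A * star (R q)) - star ?A * ?A"
    using A by blast
  also have "\<dots> = star ?A + ?A - star ?A * ?A" by (simp add: 1 2)
  also have "\<dots> = (1 - q * cnj q) *\<^sub>C 1"
    by (simp add: star_simps algebra_simps bop_scaleC_simps unitary)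
  also have "1 - q * cnj q = complex_of_real (1 - (cmod q)\<^sup>2)"
    using complex_norm_square[of q] by simp
  finally show ?thesis .
qed

text \<open>The product of two kernels has nine terms. The mixed products \<open>R * star R\<close>
  produce the two fractions; the other traces follow from \<open>R_moments\<close> and their
  conjugates.\<close>

lemma G_moments:
  assumes q: "cmod q < 1" and p: "cmod p < 1"
  defines "u \<equiv> q * cnj p"
  shows "\<tau> (G q) = 1"
    "\<tau> (G q * G p) = 1 / (1 - u) + 1 / (1 - cnj u) - 1"
    "\<tau> (W * (G q * G p)) = cnj p / (1 - u) + cnj q / (1 - cnj u)"
    "\<tau> (star W * (G q * G p)) = q / (1 - u) + p / (1 - cnj u)"
proof -
  note [simp] = mem W_mem R_mem q p tau_simps
  have W1: "\<tau> W = 0" using moment[of 1] by simp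
  then have W1': "\<tau> (star W) = 0" by (simp add: tau_star)
  note mom = R_moments[OF q p] R_moments[OF p q] R_moments[OF q q]
  have SS: "\<tau> (star (R q) * star (R p)) = 1"
    using tau_star[of "R p * R q"] by (simp add: star_mult mom)
  have S: "\<tau> (W * star (R q)) = cnj q" "\<tau> (star W * star (R q)) = 0" if "cmod q < 1" for q
    using tau_star[of "star W * R q"] tau_star[of "W * R q"] that
      commute[of "star (R q)" W] commute[of "star (R q)" "star W"]
    by (simp_all add: star_mult R_moments[OF that that])
  have WSS: "\<tau> (W * (star (R q) * star (R p))) = cnj q + cnj p"
    "\<tau> (star W * (star (R q) * star (R p))) = 0"
    using tau_star[of "star W * (R p * R q)"] tau_star[of "W * (R p * R q)"]
      commute[of "star (R q) * star (R p)" W] commute[of "star (R q) * star (R p)" "star W"]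
    by (simp_all add: star_mult mom)
  have swap: "R q * star (R p) = star (R p) * R q" by (rule commute) simp_all
  have cu: "1 - cnj u = 1 - p * cnj q" by (simp add: u_def mult.commute)
  have S1: "\<tau> (star (R q)) = 1" if "cmod q < 1" for q
    using that by (simp add: tau_star R_moments[OF that that])
  show "\<tau> (G q) = 1" by (simp add: G_def S1 mom)
  have ex: "G q * G p = R q * R p + star (R p) * R q - R q + star (R q) * R p
      + star (R q) * star (R p) - star (R q) - R p - star (R p) + 1"
    by (simp add: G_def algebra_simps swap)
  show "\<tau> (G q * G p) = 1 / (1 - u) + 1 / (1 - cnj u) - 1"
    unfolding ex cu unfolding u_def by (simp add: mom SS S1)
  show "\<tau> (W * (G q * G p)) = cnj p / (1 - u) + cnj q / (1 - cnj u)"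
    unfolding ex cu unfolding u_def by (simp add: distrib_left right_diff_distrib mom WSS S W1)
  show "\<tau> (star W * (G q * G p)) = q / (1 - u) + p / (1 - cnj u)"
    unfolding ex cu unfolding u_def by (simp add: distrib_left right_diff_distrib mom WSS S W1')
qed

end

section \<open>Scalar identities\<close>

text \<open>The numbers \<open>k\<^sub>1\<close>, \<open>k\<^sub>2\<close> of the statement are determined by these equations, and they encode the
  factorization \<open>1 + \<bar>\<alpha> - \<beta> \<zeta>\<bar>\<^sup>2 = k\<^sub>1 k\<^sub>2 \<bar>1 - q \<zeta>\<bar>\<^sup>2\<close> on the unit circle,
  where \<open>q = cnj \<alpha> \<beta> / (k\<^sub>1 k\<^sub>2)\<close>.\<close>

definition factor_pair :: "complex \<Rightarrow> complex \<Rightarrow> real \<Rightarrow> real \<Rightarrow> bool" where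
  "factor_pair \<alpha> \<beta> k l \<longleftrightarrow> 0 < k \<and> 0 < l \<and> k * l = k + (cmod \<alpha>)\<^sup>2 \<and> k * l = l + (cmod \<beta>)\<^sup>2"

definition pole :: "complex \<Rightarrow> complex \<Rightarrow> real \<Rightarrow> real \<Rightarrow> complex" where
  "pole \<alpha> \<beta> k l = cnj \<alpha> * \<beta> / complex_of_real (k * l)"

text \<open>The defining equations force \<open>k - l = r - p\<close> and then
  \<open>(k + l - 1)^2 = \<rho>^2\<close>, which explains the formulas. Positivity comes from
  \<open>|p - r| \<le> \<rho>\<close>.\<close>

lemma factor_pairI:
  fixes \<alpha> \<beta> :: complex
  defines "p \<equiv> (cmod \<alpha>)\<^sup>2" and "r \<equiv> (cmod \<beta>)\<^sup>2"
  defines "\<rho> \<equiv> sqrt (1 + 2 * p + 2 * r + (p - r)\<^sup>2)"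
  shows "factor_pair \<alpha> \<beta> ((1 + \<rho> - p + r) / 2) ((1 + \<rho> + p - r) / 2)"
proof -
  have nonneg: "0 \<le> p" "0 \<le> r" by (simp_all add: p_def r_def)
  then have "0 \<le> 1 + 2 * p + 2 * r + (p - r)\<^sup>2" by (simp add: add_nonneg_nonneg)
  then have sq: "\<rho>\<^sup>2 = 1 + 2 * p + 2 * r + (p - r)\<^sup>2" by (simp add: \<rho>_def)
  have "\<bar>p - r\<bar> \<le> \<rho>"
    unfolding \<rho>_def by (rule real_le_rsqrt) (use nonneg in simp)
  then have "0 < (1 + \<rho> - p + r) / 2" "0 < (1 + \<rho> + p - r) / 2" by simp_all
  moreover have "(1 + \<rho> - p + r) / 2 * ((1 + \<rho> + p - r) / 2) = (1 + 2 * \<rho> + \<rho>\<^sup>2 - (p - r)\<^sup>2) / 4"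
    by (simp add: power2_eq_square field_simps)
  then have prod: "(1 + \<rho> - p + r) / 2 * ((1 + \<rho> + p - r) / 2) = (1 + \<rho> + p + r) / 2"
    by (simp add: sq)
  ultimately show ?thesis
    unfolding factor_pair_def p_def[symmetric] r_def[symmetric] prod by (auto simp: field_simps)
qed

text \<open>Since \<open>|\<alpha>|^2 = k (l - 1)\<close> and
  \<open>|\<beta>|^2 = l (k - 1)\<close>, the squared modulus of the pole is
  \<open>(k - 1) (l - 1) / (k l)\<close>. The first claim supplies the normalising constant of
  \<open>H\<close>.\<close>

lemma norm_pole:
  assumes "factor_pair \<alpha> \<beta> k l"
  shows "k * l * (1 - (cmod (pole \<alpha> \<beta> k l))\<^sup>2) = k + l - 1" "1 \<le> k" "1 \<le> l" "cmod (pole \<alpha> \<beta> k l) < 1"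
proof -
  have pos: "0 < k" "0 < l" and eqs: "(cmod \<alpha>)\<^sup>2 = k * (l - 1)" "(cmod \<beta>)\<^sup>2 = l * (k - 1)"
    using assms by (auto simp: factor_pair_def algebra_simps)
  show ge: "1 \<le> k" "1 \<le> l"
    using eqs pos zero_le_power2[of "cmod \<alpha>"] zero_le_power2[of "cmod \<beta>"] by (auto simp: zero_le_mult_iff)
  have "(cmod (pole \<alpha> \<beta> k l))\<^sup>2 = (cmod \<alpha>)\<^sup>2 * (cmod \<beta>)\<^sup>2 / (k * l)\<^sup>2"
    by (simp add: pole_def norm_mult norm_divide power_mult_distrib power_divide)
  also have "\<dots> = (l - 1) * (k - 1) / (k * l)"
    unfolding eqs using pos by (simp add: power2_eq_square field_simps)
  finally have sq: "(cmod (pole \<alpha> \<beta> k l))\<^sup>2 = (l - 1) * (k - 1) / (k * l)" .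
  show *: "k * l * (1 - (cmod (pole \<alpha> \<beta> k l))\<^sup>2) = k + l - 1"
    unfolding sq using pos by (simp add: field_simps)
  then have "0 < k * l * (1 - (cmod (pole \<alpha> \<beta> k l))\<^sup>2)" using ge by linarith
  moreover have "0 < k * l" using pos by simp
  ultimately have "(cmod (pole \<alpha> \<beta> k l))\<^sup>2 < 1" using zero_less_mult_pos by fastforce
  then show "cmod (pole \<alpha> \<beta> k l) < 1" by (simp add: power_less_one_iff abs_square_less_1)
qed

text \<open>The left side is what \<open>G_moments\<close> yields for the cross term of the
  distance. Sorted by denominator, its numerators become those on the right plus multiples of
  \<open>1 - u\<close> and \<open>1 - cnj u\<close> whose quotients cancel.\<close>

lemma correlation_identity:
  fixes \<alpha> \<beta> \<alpha>' \<beta>' :: complex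
  assumes f: "factor_pair \<alpha> \<beta> k l" and f': "factor_pair \<alpha>' \<beta>' k' l'"
  defines "q \<equiv> pole \<alpha> \<beta> k l" and "p \<equiv> pole \<alpha>' \<beta>' k' l'"
  defines "u \<equiv> q * cnj p"
  defines "s \<equiv> \<alpha> * cnj \<alpha>' / complex_of_real (k * k')" and "t \<equiv> \<beta> * cnj \<beta>' / complex_of_real (l * l')"
  shows "(1 + cnj \<alpha>' * \<alpha> + cnj \<beta>' * \<beta>) * (1 / (1 - u) + 1 / (1 - cnj u) - 1)
      - cnj \<alpha>' * \<beta> * (cnj p / (1 - u) + cnj q / (1 - cnj u))
      - \<alpha> * cnj \<beta>' * (q / (1 - u) + p / (1 - cnj u))
    = (1 + t) / (1 - u) + s * (1 + cnj t) / (1 - cnj u)"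
    and "u = cnj s * t"
proof -
  define K L K' L' where "K = complex_of_real k" and "L = complex_of_real l"
    and "K' = complex_of_real k'" and "L' = complex_of_real l'"
  \<comment> \<open>In these variables \<open>q\<close>, \<open>p\<close>, \<open>s\<close>,
    \<open>t\<close> are monomials, so the claims about numerators become polynomial
    identities.\<close>
  define x y x' y' where "x = \<alpha> / K" and "y = \<beta> / L" and "x' = \<alpha>' / K'" and "y' = \<beta>' / L'"
  have nz: "K \<noteq> 0" "L \<noteq> 0" "K' \<noteq> 0" "L' \<noteq> 0"
    using f f' by (auto simp: factor_pair_def K_def L_def K'_def L'_def)
  have subst: "\<alpha> = x * K" "\<beta> = y * L" "\<alpha>' = x' * K'" "\<beta>' = y' * L'"
    using nz by (simp_all add: x_def y_def x'_def y'_def)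
  have cn: "cnj K = K" "cnj L = L" "cnj K' = K'" "cnj L' = L'"
    by (simp_all add: K_def L_def K'_def L'_def)
  have rel: "L = 1 + x * cnj x * K" "K = 1 + y * cnj y * L" if "factor_pair \<alpha> \<beta> k l"
    "\<alpha> = x * K" "\<beta> = y * L" "K = complex_of_real k" "L = complex_of_real l" "K \<noteq> 0" "L \<noteq> 0"
    for \<alpha> \<beta> k l x y K L
  proof -
    have "K * L = K + \<alpha> * cnj \<alpha>" "K * L = L + \<beta> * cnj \<beta>"
      using that(1) unfolding factor_pair_def that(4,5) complex_norm_square[symmetric]
      by (metis of_real_add of_real_mult of_real_power)+
    then have "K * L = K * (1 + x * cnj x * K)" "L * K = L * (1 + y * cnj y * L)"
      using that by (simp_all add: algebra_simps)
    then show "L = 1 + x * cnj x * K" "K = 1 + y * cnj y * L"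
      using that(6,7) mult_left_cancel by blast+
  qed
  have r: "L = 1 + x * cnj x * K" "K = 1 + y * cnj y * L"
    by (rule rel[OF f subst(1,2) K_def L_def nz(1,2)])+
  have r': "L' = 1 + x' * cnj x' * K'" "K' = 1 + y' * cnj y' * L'"
    by (rule rel[OF f' subst(3,4) K'_def L'_def nz(3,4)])+
  have q: "q = cnj x * y" "p = cnj x' * y'" "s = x * cnj x'" "t = y * cnj y'"
    using nz by (simp_all add: q_def p_def pole_def s_def t_def subst cn flip: K_def L_def K'_def L'_def)
  show u: "u = cnj s * t" by (simp add: u_def q)
  define A where "A = 1 + cnj \<alpha>' * \<alpha> + cnj \<beta>' * \<beta>"
  have N1: "A - cnj \<alpha>' * \<beta> * cnj p - \<alpha> * cnj \<beta>' * q = 1 + t + s * K * K' * (1 - u)"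
    unfolding A_def u_def q subst complex_cnj_mult cn complex_cnj_cnj using r(1) r'(1) by algebra
  have N2: "cnj u * A - cnj \<alpha>' * \<beta> * cnj q - \<alpha> * cnj \<beta>' * p = s * (1 + cnj t) - s * K * K' * (1 - cnj u)"
    unfolding A_def u_def q subst complex_cnj_mult cn complex_cnj_cnj using r(2) r'(2) by algebra
  have "cmod u < 1"
  proof -
    have "cmod q * cmod p < 1 * 1"
      unfolding q_def p_def using norm_pole(4)[OF f] norm_pole(4)[OF f'] by (intro mult_strict_mono) auto
    then show ?thesis by (simp add: u_def norm_mult)
  qed
  then have ne: "1 - u \<noteq> 0" "1 - cnj u \<noteq> 0" by (auto dest: arg_cong[of _ _ cmod])
  \<comment> \<open>Uses \<open>1 / (1 - cnj u) - 1 = cnj u / (1 - cnj u)\<close>, the source of the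
    factor \<open>cnj u\<close> in \<open>N2\<close>.\<close>
  have "A * (1 / (1 - u) + 1 / (1 - cnj u) - 1)
      - cnj \<alpha>' * \<beta> * (cnj p / (1 - u) + cnj q / (1 - cnj u))
      - \<alpha> * cnj \<beta>' * (q / (1 - u) + p / (1 - cnj u))
    = (A - cnj \<alpha>' * \<beta> * cnj p - \<alpha> * cnj \<beta>' * q) / (1 - u)
      + (cnj u * A - cnj \<alpha>' * \<beta> * cnj q - \<alpha> * cnj \<beta>' * p) / (1 - cnj u)"
    using ne by (simp add: divide_simps) algebra
  also have "\<dots> = (1 + t) / (1 - u) + s * (1 + cnj t) / (1 - cnj u)"
    unfolding N1 N2 using ne by (simp add: add_divide_distrib diff_divide_distrib)
  finally show "(1 + cnj \<alpha>' * \<alpha> + cnj \<beta>' * \<beta>) * (1 / (1 - u) + 1 / (1 - cnj u) - 1)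
      - cnj \<alpha>' * \<beta> * (cnj p / (1 - u) + cnj q / (1 - cnj u))
      - \<alpha> * cnj \<beta>' * (q / (1 - u) + p / (1 - cnj u))
    = (1 + t) / (1 - u) + s * (1 + cnj t) / (1 - cnj u)" unfolding A_def .
qed

section \<open>Linear functions of a Haar unitary\<close>

context haar_algebra
begin

text \<open>This is \<open>star V1 * T(z)\<close>, with the square roots and the dependence on
  \<open>z\<close> absorbed into the two scalars.\<close>

definition F :: "complex \<Rightarrow> complex \<Rightarrow> 'h bop" where
  "F \<alpha> \<beta> = \<alpha> *\<^sub>C 1 - \<beta> *\<^sub>C W"

text \<open>The inverse of \<open>1 + star F * F\<close>, as a multiple of a Poisson kernel; for the
  numbers of the theorem, \<open>k + l - 1\<close> is \<open>\<rho>(z)\<close>.\<close>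

definition H :: "complex \<Rightarrow> complex \<Rightarrow> real \<Rightarrow> real \<Rightarrow> 'h bop" where
  "H \<alpha> \<beta> k l = complex_of_real (1 / (k + l - 1)) *\<^sub>C G (pole \<alpha> \<beta> k l)"

lemma F_mem: "F \<alpha> \<beta> \<in> M"
  by (simp add: F_def mem W_mem)

lemma H_mem: "factor_pair \<alpha> \<beta> k l \<Longrightarrow> H \<alpha> \<beta> k l \<in> M"
  by (simp add: H_def mem G_mem norm_pole)

lemma star_H: "star (H \<alpha> \<beta> k l) = H \<alpha> \<beta> k l"
  by (simp add: H_def G_def star_simps add.commute)

lemma star_F_F: "star (F \<alpha>' \<beta>') * F \<alpha> \<beta>
    = (cnj \<alpha>' * \<alpha> + cnj \<beta>' * \<beta>) *\<^sub>C 1 - (cnj \<alpha>' * \<beta>) *\<^sub>C W - (\<alpha> * cnj \<beta>') *\<^sub>C star W"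
  by (simp add: F_def star_simps left_diff_distrib right_diff_distrib bop_scaleC_simps unitary)
    (simp add: algebra_simps)

text \<open>Comparing the coefficients of \<open>1\<close>, \<open>W\<close> and
  \<open>star W\<close> gives the Fejer-Riesz factorization of \<open>1 + star F * F\<close> as
  \<open>k l\<close> times \<open>star (1 - q W) * (1 - q W)\<close>. Then \<open>G_inverse\<close>
  applies, and its constant cancels by \<open>norm_pole\<close>.\<close>

lemma H_inverse:
  assumes f: "factor_pair \<alpha> \<beta> k l"
  shows "(1 + star (F \<alpha> \<beta>) * F \<alpha> \<beta>) * H \<alpha> \<beta> k l = 1"
proof -
  define q where "q = pole \<alpha> \<beta> k l"
  define C where "C = complex_of_real (k * l)"
  have pos: "k + l - 1 \<noteq> 0" using norm_pole(2,3)[OF f] by simp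
  have C0: "C \<noteq> 0"
    unfolding C_def of_real_eq_0_iff using norm_pole(2,3)[OF f] by simp
  have c: "cnj C = C" by (simp add: C_def)
  have Cq: "C * q = cnj \<alpha> * \<beta>" "C * cnj q = \<alpha> * cnj \<beta>"
    using C0 unfolding q_def pole_def C_def[symmetric] by (simp_all add: c)
  \<comment> \<open>The constant coefficient, from the sum of the two equations of
    \<open>factor_pair\<close> and the value of \<open>k l (1 - |q|^2)\<close>.\<close>
  have "k * l * (1 + (cmod q)\<^sup>2) = k * l + k * l - k * l * (1 - (cmod q)\<^sup>2)"
    by (simp add: algebra_simps)
  also have "\<dots> = (k + (cmod \<alpha>)\<^sup>2) + (l + (cmod \<beta>)\<^sup>2) - (k + l - 1)"
    using f norm_pole(1)[OF f] unfolding factor_pair_def q_def by linarith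
  finally have "k * l * (1 + (cmod q)\<^sup>2) = 1 + (cmod \<alpha>)\<^sup>2 + (cmod \<beta>)\<^sup>2" by simp
  then have "C * (1 + q * cnj q) = 1 + \<alpha> * cnj \<alpha> + \<beta> * cnj \<beta>"
    unfolding C_def complex_norm_square[symmetric]
    by (metis of_real_1 of_real_add of_real_mult of_real_power)
  then have Cqq: "C + C * (q * cnj q) = 1 + cnj \<alpha> * \<alpha> + cnj \<beta> * \<beta>" by (simp add: algebra_simps)
  have "C *\<^sub>C (star (1 - q *\<^sub>C W) * (1 - q *\<^sub>C W))
      = (C + C * (q * cnj q)) *\<^sub>C 1 - (C * q) *\<^sub>C W - (C * cnj q) *\<^sub>C star W"
    by (simp add: star_simps left_diff_distrib right_diff_distrib bop_scaleC_simps unitary)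
  also have "\<dots> = 1 + star (F \<alpha> \<beta>) * F \<alpha> \<beta>"
    unfolding Cq Cqq star_F_F by (simp add: bop_scaleC_simps)
  finally have eq: "1 + star (F \<alpha> \<beta>) * F \<alpha> \<beta> = C *\<^sub>C (star (1 - q *\<^sub>C W) * (1 - q *\<^sub>C W))" ..
  have "(1 + star (F \<alpha> \<beta>) * F \<alpha> \<beta>) * H \<alpha> \<beta> k l
      = (C * complex_of_real (1 / (k + l - 1)) * complex_of_real (1 - (cmod q)\<^sup>2)) *\<^sub>C 1"
    unfolding eq H_def q_def[symmetric] bop_scaleC_simps G_inverse[OF norm_pole(4)[OF f, folded q_def]]
    by (simp add: mult.commute)
  also have "C * complex_of_real (1 / (k + l - 1)) * complex_of_real (1 - (cmod q)\<^sup>2)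
      = complex_of_real (k * l * (1 - (cmod q)\<^sup>2) / (k + l - 1))"
    by (simp add: C_def)
  also have "k * l * (1 - (cmod q)\<^sup>2) / (k + l - 1) = 1"
    using norm_pole(1)[OF f] pos by (simp add: q_def)
  finally show ?thesis by simp
qed

lemma tau_H: "factor_pair \<alpha> \<beta> k l \<Longrightarrow> \<tau> (H \<alpha> \<beta> k l) = complex_of_real (1 / (k + l - 1))"
  using norm_pole(4)[of \<alpha> \<beta> k l] G_moments(1)[of "pole \<alpha> \<beta> k l" "pole \<alpha> \<beta> k l"]
  by (simp add: H_def tau_simps mem G_mem)

lemma tau_correlation:
  assumes f: "factor_pair \<alpha> \<beta> k l" and f': "factor_pair \<alpha>' \<beta>' k' l'"
  defines "s \<equiv> \<alpha> * cnj \<alpha>' / complex_of_real (k * k')" and "t \<equiv> \<beta> * cnj \<beta>' / complex_of_real (l * l')"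
  shows "Re (\<tau> (H \<alpha> \<beta> k l * H \<alpha>' \<beta>' k' l' * (1 + star (F \<alpha>' \<beta>') * F \<alpha> \<beta>)))
    = Re ((1 + cnj s) * (1 + t) / (1 - cnj s * t)) / ((k + l - 1) * (k' + l' - 1))"
proof -
  define q p where "q = pole \<alpha> \<beta> k l" and "p = pole \<alpha>' \<beta>' k' l'"
  define u where "u = q * cnj p"
  have qp: "cmod q < 1" "cmod p < 1" using norm_pole(4) f f' by (auto simp: q_def p_def)
  define c where "c = 1 / ((k + l - 1) * (k' + l' - 1))"
  have Re_cnj: "Re (complex_of_real c * (x + cnj v)) = c * Re (x + v)" for x v by simp
  note [simp] = mem W_mem G_mem qp tau_simps
  have "H \<alpha> \<beta> k l * H \<alpha>' \<beta>' k' l' * (1 + star (F \<alpha>' \<beta>') * F \<alpha> \<beta>)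
      = complex_of_real c *\<^sub>C ((1 + star (F \<alpha>' \<beta>') * F \<alpha> \<beta>) * (G q * G p))"
    unfolding H_def q_def[symmetric] p_def[symmetric] c_def
    using commute[of "1 + star (F \<alpha>' \<beta>') * F \<alpha> \<beta>" "G q * G p"]
    by (simp add: F_mem bop_scaleC_simps mult.commute)
  also have "(1 + star (F \<alpha>' \<beta>') * F \<alpha> \<beta>) * (G q * G p)
      = (1 + cnj \<alpha>' * \<alpha> + cnj \<beta>' * \<beta>) *\<^sub>C (G q * G p)
        - (cnj \<alpha>' * \<beta>) *\<^sub>C (W * (G q * G p)) - (\<alpha> * cnj \<beta>') *\<^sub>C (star W * (G q * G p))"
    unfolding star_F_F by (simp add: left_diff_distrib distrib_right bop_scaleC_simps)
  finally have "\<tau> (H \<alpha> \<beta> k l * H \<alpha>' \<beta>' k' l' * (1 + star (F \<alpha>' \<beta>') * F \<alpha> \<beta>))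
    = complex_of_real c * ((1 + cnj \<alpha>' * \<alpha> + cnj \<beta>' * \<beta>) * (1 / (1 - u) + 1 / (1 - cnj u) - 1)
      - cnj \<alpha>' * \<beta> * (cnj p / (1 - u) + cnj q / (1 - cnj u))
      - \<alpha> * cnj \<beta>' * (q / (1 - u) + p / (1 - cnj u)))"
    by (simp only: tau_scaleC tau_diff mem W_mem G_mem qp G_moments(2-4)[OF qp] u_def)
  also have "\<dots> = complex_of_real c * ((1 + t) / (1 - u) + s * (1 + cnj t) / (1 - cnj u))"
    unfolding s_def t_def u_def q_def p_def using correlation_identity(1)[OF f f'] by simp
  also have "u = cnj s * t"
    unfolding s_def t_def u_def q_def p_def by (rule correlation_identity(2)[OF f f'])
  \<comment> \<open>The second fraction is the conjugate of one with the first denominator; under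
    \<open>Re\<close> the conjugation disappears and the two combine.\<close>
  also have "s * (1 + cnj t) / (1 - cnj (cnj s * t)) = cnj (cnj s * (1 + t) / (1 - cnj s * t))"
    by simp
  also have "Re (complex_of_real c * ((1 + t) / (1 - cnj s * t) + cnj (cnj s * (1 + t) / (1 - cnj s * t))))
      = c * Re ((1 + t) / (1 - cnj s * t) + cnj s * (1 + t) / (1 - cnj s * t))"
    by (rule Re_cnj)
  also have "(1 + t) / (1 - cnj s * t) + cnj s * (1 + t) / (1 - cnj s * t) = (1 + cnj s) * (1 + t) / (1 - cnj s * t)"
    by (simp add: add_divide_distrib distrib_right)
  finally show ?thesis by (simp add: c_def)
qed

text \<open>From \<open>(1 + star A * A) * X = 1\<close> one gets
  \<open>X * X + star (A * X) * (A * X) = X\<close>, and likewise for \<open>Y\<close>. By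
  commutativity the cross terms are \<open>X * Y * (1 + star B * A)\<close> and its adjoint.\<close>

lemma distance_identity:
  assumes f: "factor_pair \<alpha> \<beta> k l" and f': "factor_pair \<alpha>' \<beta>' k' l'"
  defines "A \<equiv> F \<alpha> \<beta>" and "B \<equiv> F \<alpha>' \<beta>'" and "X \<equiv> H \<alpha> \<beta> k l" and "Y \<equiv> H \<alpha>' \<beta>' k' l'"
  shows "Re (\<tau> (star (X - Y) * (X - Y))) + Re (\<tau> (star (A * X - B * Y) * (A * X - B * Y)))
    = Re (\<tau> X) + Re (\<tau> Y) - 2 * Re (\<tau> (X * Y * (1 + star B * A)))"
proof -
  have m: "A \<in> M" "B \<in> M" "X \<in> M" "Y \<in> M"
    using f f' by (simp_all add: A_def B_def X_def Y_def F_mem H_mem)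
  note [simp] = mem m tau_simps
  have st: "star X = X" "star Y = Y" by (simp_all add: X_def Y_def star_H)
  have inv: "star A * (A * X) = 1 - X" "star B * (B * Y) = 1 - Y"
    using H_inverse[OF f] H_inverse[OF f'] unfolding A_def B_def X_def Y_def
    by (simp_all add: distrib_right mult.assoc eq_diff_eq add.commute)
  have c: "Y * X = X * Y" by (rule commute) simp_all
  have c1: "X * (star A * (B * Y)) = X * Y * (star A * B)"
    using commute[of "star A * B" Y] by (simp add: mult.assoc)
  have "Y * (star B * (A * X)) = Y * X * (star B * A)"
    using commute[of "star B * A" X] by (simp add: mult.assoc)
  then have c2: "Y * (star B * (A * X)) = X * Y * (star B * A)" by (simp add: c)
  have "star (X - Y) * (X - Y) + star (A * X - B * Y) * (A * X - B * Y)
      = X + Y - X * Y * (1 + star B * A) - X * Y * (1 + star A * B)"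
    by (simp only: star_diff star_mult st left_diff_distrib right_diff_distrib mult.assoc,
        simp only: inv c1 c2 c, simp add: algebra_simps)
  then have "\<tau> (star (X - Y) * (X - Y)) + \<tau> (star (A * X - B * Y) * (A * X - B * Y))
      = \<tau> (X + Y - X * Y * (1 + star B * A) - X * Y * (1 + star A * B))"
    by (subst tau_add[symmetric]) simp_all
  also have "\<dots> = \<tau> X + \<tau> Y - \<tau> (X * Y * (1 + star B * A)) - \<tau> (X * Y * (1 + star A * B))"
    by (simp del: distrib_left)
  also have "X * Y * (1 + star A * B) = star (X * Y * (1 + star B * A))"
    using commute[of "1 + star A * B" "Y * X"] by (simp add: star_simps st c)
  also have "\<tau> \<dots> = cnj (\<tau> (X * Y * (1 + star B * A)))" by (rule tau_star) simp
  finally show ?thesis by (simp add: complex_eq_iff)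
qed

end

section \<open>The distance\<close>

locale trace_algebra = state_algebra M \<tau>
  for M :: "'h::chilbert_space bop set" and \<tau> +
  assumes trace: "A \<in> M \<Longrightarrow> B \<in> M \<Longrightarrow> \<tau> (A * B) = \<tau> (B * A)"
begin

lemma trace_conjugate:
  assumes "U \<in> M" "star U * U = 1" "A \<in> M"
  shows "\<tau> (U * A * star U) = \<tau> A"
  using trace[of "U * A" "star U"] assms by (simp add: mem mult.assoc[symmetric])

text \<open>By traciality both diagonal entries contribute \<open>\<tau> (star Z * Z)\<close> and
  both off-diagonal ones \<open>\<tau> (star D * D)\<close>; the normalized trace halves the doubled
  sum.\<close>

lemma norm2_block:
  assumes U: "U \<in> M" "star U * U = 1" and Z: "Z \<in> M" and D: "D \<in> M"
  shows "norm2 \<tau> (vector [vector [- (U * Z * star U), U * D], vector [star (U * D), Z]])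
    = sqrt (Re (\<tau> (star Z * Z)) + Re (\<tau> (star D * D)))"
proof -
  have cancel: "star U * (U * A) = A" for A using U by (simp add: mult.assoc[symmetric])
  have 1: "\<tau> (star (U * Z * star U) * (U * Z * star U)) = \<tau> (star Z * Z)"
    using trace_conjugate[of U "star Z * Z"] U Z by (simp add: star_mult mult.assoc cancel mem)
  have 2: "star (U * D) * (U * D) = star D * D"
    by (simp add: star_mult mult.assoc cancel)
  have 3: "\<tau> (U * D * star (U * D)) = \<tau> (star D * D)"
    using trace[of "U * D" "star (U * D)"] U D by (simp add: mem 2)
  show ?thesis
    unfolding norm2_def tau2_def mstar_def matrix_matrix_mult_def
    using U Z D by (simp add: sum_2 tau_simps mem 1 2 3 star_minus)
qed

end

section \<open>Removing the outer unitary from the projections\<close>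

lemma Q_proj_Fin:
  assumes T: "T_op K1 K2 V1 V2 z = U * A" and U: "star U * U = 1" "U * star U = 1"
    and A: "A * star A = star A * A" and X: "(1 + star A * A) * X = 1" "X * (1 + star A * A) = 1" "star X = X"
  shows "Q_proj K1 K2 V1 V2 (Fin z)
    = vector [vector [1 - U * X * star U, U * (A * X)], vector [star (U * (A * X)), X]]"
proof -
  have cancel: "star U * (U * C) = C" for C using U by (simp add: mult.assoc[symmetric])
  have inv1: "op_inv (1 + star (U * A) * (U * A)) = X"
    using X by (intro op_inv_eqI) (simp_all add: star_mult mult.assoc cancel)
  have inv2: "op_inv (1 + (U * A) * star (U * A)) = U * X * star U"
  proof (rule op_inv_eqI)
    \<comment> \<open>Normality of \<open>A\<close> turns \<open>T * star T\<close> into the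
      conjugate of \<open>star A * A\<close> by \<open>U\<close>, so one inverse \<open>X\<close>
      serves both corners.\<close>
    have *: "1 + (U * A) * star (U * A) = U * (1 + star A * A) * star U"
    proof -
      have "U * (1 + star A * A) * star U = U * star U + U * (A * star A) * star U"
        unfolding A by (simp add: distrib_left distrib_right)
      then show ?thesis by (simp add: U(2) star_mult mult.assoc)
    qed
    show "(1 + (U * A) * star (U * A)) * (U * X * star U) = 1"
      using arg_cong[OF X(1), of "\<lambda>B. U * B * star U"] unfolding *
      by (simp add: mult.assoc cancel U(2))
    show "U * X * star U * (1 + (U * A) * star (U * A)) = 1"
      using arg_cong[OF X(2), of "\<lambda>B. U * B * star U"] unfolding *
      by (simp add: mult.assoc cancel U(2))
  qed
  have inv3: "X * star (U * A) = star (U * (A * X))"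
    by (simp add: star_mult X(3) mult.assoc)
  show ?thesis
    unfolding Q_proj.simps Let_def T inv1 inv2 inv3 mult.assoc[of U A X] ..
qed

section \<open>The commutative algebra of \<open>W\<close> and the consequence of freeness\<close>

lemma haar_algebra_double_commutant:
  assumes N: "vN_algebra N" "state_algebra N \<tau>" and W: "W \<in> N" "star W * W = 1" "W * star W = 1"
    and moment: "\<And>m. 1 \<le> m \<Longrightarrow> \<tau> (W ^ m) = 0"
  shows "haar_algebra (commutant (commutant {W, star W})) \<tau> W"
    and "commutant (commutant {W, star W}) \<subseteq> N"
proof -
  interpret N: state_algebra N \<tau> by fact
  let ?S = "{W, star W}"
  let ?M = "commutant (commutant ?S)"
  have "?M \<subseteq> commutant (commutant N)"
    by (intro commutant_antimono) (use W N.star_mem in auto)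
  then show sub: "?M \<subseteq> N" using N(1) by (simp add: vN_algebra_def)
  \<comment> \<open>As \<open>W\<close> is normal, the double commutant lies inside the commutant,
    so any two of its elements commute.\<close>
  have "?S \<subseteq> commutant ?S" using W by (auto simp: commutant_def)
  then have comm: "?M \<subseteq> commutant ?S" by (rule commutant_antimono)
  interpret M: operator_algebra ?M
    by (intro operator_algebra_commutant star_commutant) auto
  show "haar_algebra ?M \<tau> W"
  proof
    show "A * B = B * A" if "A \<in> ?M" "B \<in> ?M" for A B
      using that comm by (auto simp: commutant_def)
    show "W \<in> ?M" by (simp add: commutant_def)
  qed (simp_all add: N.tau_add N.tau_scaleC N.tau_pos N.tau_one W moment subsetD[OF sub])
qed

text \<open>The power is an alternating word of length \<open>2 m\<close> in the centred letters
  \<open>star U\<close> and \<open>V\<close>, so freeness annihilates it.\<close>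

lemma free_unitaries_moment:
  assumes free: "free_unitaries \<tau> U V" and zero: "\<tau> (star U) = 0" "\<tau> V = 0" and m: "1 \<le> m"
  shows "\<tau> ((star U * V) ^ m) = 0"
proof -
  define xs where "xs m = concat (replicate m [(True, star U), (False, V)])" for m
  have ne: "xs m \<noteq> []" using m by (cases m) (auto simp: xs_def)
  have letters: "\<forall>(i, A)\<in>set (xs m). A \<in> vN_generated {if i then U else V} \<and> \<tau> A = 0"
    using zero by (auto simp: xs_def vN_generated_mem)
  \<comment> \<open>The first letter is tracked as well: a block ends with index
    \<open>False\<close>, so the next must start with \<open>True\<close>.\<close>
  have alt: "distinct_adj (map fst (xs m)) \<and> (m \<noteq> 0 \<longrightarrow> hd (map fst (xs m)))" for m
    by (induction m) (auto simp: xs_def distinct_adj_Cons)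
  have word: "prod_list (map snd (xs m)) = (star U * V) ^ m" for m
    by (induction m) (simp_all add: xs_def mult.assoc)
  have "freely_independent \<tau> (\<lambda>first::bool. vN_generated {if first then U else V})"
    using free by (simp add: free_unitaries_def)
  then have "\<tau> (prod_list (map snd (xs m))) = 0"
    unfolding freely_independent_def using ne letters conjunct1[OF alt[of m]] by blast
  then show ?thesis by (simp only: word)
qed

section \<open>Specialization to scalar \<open>K1\<close> and \<open>K2\<close>\<close>

lemma T_op_scalar:
  assumes "0 < a" "a < 1" "0 < b" "b < 1"
  shows "T_op (complex_of_real a *\<^sub>C 1) (complex_of_real b *\<^sub>C 1) V1 V2 z
    = (complex_of_real (sqrt (a / (1 - a))) * (1 + z)) *\<^sub>C V1 - (complex_of_real (sqrt (b / (1 - b))) * z) *\<^sub>C V2"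
proof -
  have "op_sqrt (complex_of_real c *\<^sub>C 1 * op_inv (1 - complex_of_real c *\<^sub>C 1))
      = complex_of_real (sqrt (c / (1 - c))) *\<^sub>C (1 :: 'a bop)" if "0 < c" "c < 1" for c
  proof -
    have "1 - complex_of_real c *\<^sub>C 1 = complex_of_real (1 - c) *\<^sub>C (1 :: 'a bop)"
      by (simp add: bop_scaleC_simps)
    moreover have "complex_of_real (1 - c) \<noteq> 0"
      unfolding of_real_eq_0_iff using that by simp
    then have "op_inv (complex_of_real (1 - c) *\<^sub>C (1 :: 'a bop)) = inverse (complex_of_real (1 - c)) *\<^sub>C 1"
      by (rule op_inv_scalar)
    ultimately have "complex_of_real c *\<^sub>C 1 * op_inv (1 - complex_of_real c *\<^sub>C 1)
        = complex_of_real (c / (1 - c)) *\<^sub>C (1 :: 'a bop)"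
      by (simp add: bop_scaleC_simps divide_inverse mult.commute)
    then show ?thesis using that by (simp add: op_sqrt_scalar del: of_real_divide)
  qed
  then show ?thesis using assms by (simp add: T_op_def bop_scaleC_simps mult.commute)
qed

text \<open>Matches the explicit functions of the statement with the abstract data:
  \<open>\<rho>\<close> is \<open>k + l - 1\<close>, and \<open>O1\<close>, \<open>O2\<close> are
  the \<open>s\<close>, \<open>t\<close> of \<open>tau_correlation\<close>.\<close>

lemma factor_pair_k1_k2:
  assumes "0 < a" "a < 1" "0 < b" "b < 1"
  defines "\<alpha> \<equiv> \<lambda>z. complex_of_real (sqrt (a / (1 - a))) * (1 + z)"
    and "\<beta> \<equiv> \<lambda>z. complex_of_real (sqrt (b / (1 - b))) * z"
  shows "factor_pair (\<alpha> z) (\<beta> z) (k1 a b z) (k2 a b z)"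
    and "k1 a b z + k2 a b z - 1 = rho a b z"
    and "\<alpha> z * cnj (\<alpha> w) / complex_of_real (k1 a b z * k1 a b w) = O1 a b z w"
    and "\<beta> z * cnj (\<beta> w) / complex_of_real (k2 a b z * k2 a b w) = O2 a b z w"
proof -
  have ab: "0 \<le> a / (1 - a)" "0 \<le> b / (1 - b)" using assms(1-4) by simp_all
  have sq: "(cmod (\<alpha> z))\<^sup>2 = a / (1 - a) * (cmod (1 + z))\<^sup>2" "(cmod (\<beta> z))\<^sup>2 = b / (1 - b) * (cmod z)\<^sup>2"
    using ab by (simp_all add: \<alpha>_def \<beta>_def norm_mult power_mult_distrib)
  have rho: "rho a b z = sqrt (1 + 2 * (cmod (\<alpha> z))\<^sup>2 + 2 * (cmod (\<beta> z))\<^sup>2 + ((cmod (\<alpha> z))\<^sup>2 - (cmod (\<beta> z))\<^sup>2)\<^sup>2)"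
    by (simp add: rho_def sq)
  show "factor_pair (\<alpha> z) (\<beta> z) (k1 a b z) (k2 a b z)"
    using factor_pairI[of "\<alpha> z" "\<beta> z", folded rho]
    by (simp add: k1_def k2_def sq add.commute[of z 1])
  show "k1 a b z + k2 a b z - 1 = rho a b z"
    by (simp add: k1_def k2_def field_simps)
  have sqrt: "complex_of_real (sqrt c) * complex_of_real (sqrt c) = complex_of_real c" if "0 \<le> c" for c
    using that by (simp flip: of_real_mult)
  have "\<alpha> z * cnj (\<alpha> w) = (complex_of_real (sqrt (a / (1 - a))) * complex_of_real (sqrt (a / (1 - a))))
      * ((1 + z) * (1 + cnj w))"
    unfolding \<alpha>_def
    by (simp only: complex_cnj_mult complex_cnj_complex_of_real complex_cnj_add complex_cnj_one mult_ac)
  then show "\<alpha> z * cnj (\<alpha> w) / complex_of_real (k1 a b z * k1 a b w) = O1 a b z w"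
    unfolding sqrt[OF ab(1)] by (simp add: O1_def mult.assoc)
  have "\<beta> z * cnj (\<beta> w) = (complex_of_real (sqrt (b / (1 - b))) * complex_of_real (sqrt (b / (1 - b))))
      * (z * cnj w)"
    unfolding \<beta>_def by (simp only: complex_cnj_mult complex_cnj_complex_of_real mult_ac)
  then show "\<beta> z * cnj (\<beta> w) / complex_of_real (k2 a b z * k2 a b w) = O2 a b z w"
    unfolding sqrt[OF ab(2)] by (simp add: O2_def mult.assoc)
qed

theorem proposition3p2:
  fixes N :: "'h::chilbert_space bop set"
    and \<tau> :: "'h bop \<Rightarrow> complex"
    and K1 K2 V1 V2 :: "'h bop"
    and a b :: real
  assumes "type_II1_factor N"
    and "tracial_state N \<tau>" and "faithful N \<tau>" and "normal_state N \<tau>"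
    and "0 < a" and "a < 1" and "0 < b" and "b < 1"
    and "K1 = complex_of_real a *\<^sub>C 1" and "K2 = complex_of_real b *\<^sub>C 1"
    and "V1 \<in> N" and "V2 \<in> N"
    and "free_unitaries \<tau> V1 V2"
    and "\<tau> V1 = 0" and "\<tau> V2 = 0"
    and "op_ker (op_sqrt (K1 * op_inv (1 - K1)) * V1 - op_sqrt (K2 * op_inv (1 - K2)) * V2) = {0}"
  shows "(\<forall>z w. d_metric \<tau> K1 K2 V1 V2 (Fin z) (Fin w) =
            sqrt (1 / rho a b z + 1 / rho a b w
              - 2 / (rho a b z * rho a b w)
                * Re ((1 + cnj (O1 a b z w)) * (1 + O2 a b z w)
                      / (1 - cnj (O1 a b z w) * O2 a b z w))))
       \<and> (\<forall>z. d_metric \<tau> K1 K2 V1 V2 (Fin z) Infty = 1 / sqrt (rho a b z))"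
proof -
  have vN: "vN_algebra N" using assms(1) by (simp add: type_II1_factor_def factor_def)
  interpret N: operator_algebra N by (rule operator_algebra_vN[OF vN])
  interpret N: trace_algebra N \<tau>
    by standard (use assms(2) in \<open>auto simp: tracial_state_def\<close>)
  have V1: "star V1 * V1 = 1" "V1 * star V1 = 1" and V2: "star V2 * V2 = 1" "V2 * star V2 = 1"
    using assms(13) by (auto simp: free_unitaries_def unitary_op_def)
  define W where "W = star V1 * V2"
  define M where "M = commutant (commutant {W, star W})"
  have W: "W \<in> N" "star W * W = 1" "W * star W = 1"
  proof -
    show "W \<in> N" using assms(11,12) by (simp add: W_def N.mem)
    have "star W * W = star V2 * (V1 * star V1) * V2" "W * star W = star V1 * (V2 * star V2) * V1"
      by (simp_all add: W_def star_mult mult.assoc)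
    then show "star W * W = 1" "W * star W = 1" using V1 V2 by simp_all
  qed
  have "\<tau> (star V1) = 0" using assms(11,14) by (simp add: N.tau_star)
  then have moment: "\<tau> (W ^ m) = 0" if "1 \<le> m" for m
    unfolding W_def by (rule free_unitaries_moment[OF assms(13) _ assms(15) that])
  \<comment> \<open>Commutative computations take place in \<open>M\<close>; traces involving
    \<open>V1\<close> itself are treated in \<open>N\<close>.\<close>
  interpret M: haar_algebra M \<tau> W
    unfolding M_def by (rule haar_algebra_double_commutant[OF vN N.state_algebra_axioms W moment])
  have sub: "M \<subseteq> N"
    unfolding M_def by (rule haar_algebra_double_commutant[OF vN N.state_algebra_axioms W moment])
  define \<alpha> \<beta> where "\<alpha> z = complex_of_real (sqrt (a / (1 - a))) * (1 + z)"
    and "\<beta> z = complex_of_real (sqrt (b / (1 - b))) * z" for z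
  define A where "A z = M.F (\<alpha> z) (\<beta> z)" for z
  define X where "X z = M.H (\<alpha> z) (\<beta> z) (k1 a b z) (k2 a b z)" for z
  note k = factor_pair_k1_k2[OF assms(5-8), folded \<alpha>_def \<beta>_def]
  have memM: "A z \<in> M" "X z \<in> M" for z
    using k(1) by (simp_all add: A_def X_def M.F_mem M.H_mem)
  then have mem: "A z \<in> N" "X z \<in> N" for z using sub by auto
  have inv: "(1 + star (A z) * A z) * X z = 1" for z
    unfolding A_def X_def by (rule M.H_inverse[OF k(1)])
  have stX: "star (X z) = X z" for z by (simp add: X_def M.star_H)
  have "V1 * W = V2" by (simp add: W_def mult.assoc[symmetric] V1)
  then have "T_op K1 K2 V1 V2 z = V1 * A z" for z
    unfolding assms(9,10) T_op_scalar[OF assms(5-8)]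
    by (simp add: A_def M.F_def \<alpha>_def \<beta>_def right_diff_distrib bop_scaleC_simps)
  then have Q: "Q_proj K1 K2 V1 V2 (Fin z)
      = vector [vector [1 - V1 * X z * star V1, V1 * (A z * X z)], vector [star (V1 * (A z * X z)), X z]]" for z
  proof (rule Q_proj_Fin[OF _ V1 _ inv _ stX])
    show "A z * star (A z) = star (A z) * A z" by (intro M.commute M.mem memM)
    have "X z * (1 + star (A z) * A z) = (1 + star (A z) * A z) * X z" by (intro M.commute M.mem memM)
    then show "X z * (1 + star (A z) * A z) = 1" by (simp only: inv)
  qed
  have tau_X: "Re (\<tau> (X z)) = 1 / rho a b z" for z
    using M.tau_H[OF k(1)] by (simp add: X_def k(2) del: of_real_divide)
  have fin: "d_metric \<tau> K1 K2 V1 V2 (Fin z) (Fin w) =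
            sqrt (1 / rho a b z + 1 / rho a b w
              - 2 / (rho a b z * rho a b w)
                * Re ((1 + cnj (O1 a b z w)) * (1 + O2 a b z w)
                      / (1 - cnj (O1 a b z w) * O2 a b z w)))" for z w
  proof -
    \<comment> \<open>The identities in the upper corners cancel, leaving the block shape of
      \<open>norm2_block\<close>.\<close>
    have "Q_proj K1 K2 V1 V2 (Fin z) - Q_proj K1 K2 V1 V2 (Fin w)
        = vector [vector [- (V1 * (X z - X w) * star V1), V1 * (A z * X z - A w * X w)],
            vector [star (V1 * (A z * X z - A w * X w)), X z - X w]]"
      unfolding Q by (simp add: vec_eq_iff forall_2 star_simps left_diff_distrib right_diff_distrib)
    then have "d_metric \<tau> K1 K2 V1 V2 (Fin z) (Fin w)
        = sqrt (Re (\<tau> (star (X z - X w) * (X z - X w)))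
            + Re (\<tau> (star (A z * X z - A w * X w) * (A z * X z - A w * X w))))"
      unfolding d_metric_def by (simp only: N.norm2_block[OF assms(11) V1(1)] N.mem mem)
    also have "Re (\<tau> (star (X z - X w) * (X z - X w)))
          + Re (\<tau> (star (A z * X z - A w * X w) * (A z * X z - A w * X w)))
        = 1 / rho a b z + 1 / rho a b w - 2 * Re (\<tau> (X z * X w * (1 + star (A w) * A z)))"
      using M.distance_identity[OF k(1) k(1), of z w] unfolding A_def[symmetric] X_def[symmetric] tau_X .
    also have "Re (\<tau> (X z * X w * (1 + star (A w) * A z)))
        = Re ((1 + cnj (O1 a b z w)) * (1 + O2 a b z w) / (1 - cnj (O1 a b z w) * O2 a b z w))
          / (rho a b z * rho a b w)"
      using M.tau_correlation[OF k(1) k(1), of z w] unfolding k(2-4) A_def[symmetric] X_def[symmetric] .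
    finally show ?thesis by simp
  qed
  have "d_metric \<tau> K1 K2 V1 V2 (Fin z) Infty = 1 / sqrt (rho a b z)" for z
  proof -
    \<comment> \<open>The only nonzero entry of the projection at infinity cancels the identity in
      the corner, so \<open>norm2_block\<close> applies with \<open>Z = X z\<close>.\<close>
    have "Q_proj K1 K2 V1 V2 (Fin z) - Q_proj K1 K2 V1 V2 Infty
        = vector [vector [- (V1 * X z * star V1), V1 * (A z * X z)],
            vector [star (V1 * (A z * X z)), X z]]"
      unfolding Q by (simp add: vec_eq_iff forall_2)
    then have "d_metric \<tau> K1 K2 V1 V2 (Fin z) Infty
        = sqrt (Re (\<tau> (X z * X z)) + Re (\<tau> (star (A z * X z) * (A z * X z))))"
      unfolding d_metric_def by (simp only: N.norm2_block[OF assms(11) V1(1)] N.mem mem stX)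
    also have "Re (\<tau> (X z * X z)) + Re (\<tau> (star (A z * X z) * (A z * X z)))
        = Re (\<tau> (X z * X z + star (A z * X z) * (A z * X z)))"
      by (subst N.tau_add) (simp_all add: N.mem mem)
    \<comment> \<open>The last factor is \<open>1\<close> by \<open>inv\<close>, so only the trace
      of \<open>X z\<close> remains.\<close>
    also have "X z * X z + star (A z * X z) * (A z * X z) = X z * ((1 + star (A z) * A z) * X z)"
      by (simp add: star_mult stX algebra_simps)
    finally show ?thesis by (simp add: inv tau_X real_sqrt_divide)
  qed
  with fin show ?thesis by blast
qed

end
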